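(* Let $h=h(\hat x,\hat p)$ be a self-adjoint operator on the oscillator Hilbert space $L^2(\mathbb{R})$ that is an analytic function of the quadrature operators $\hat x,\hat p$, let $\omega = e^{-ih}$ (a unitary operator), and let $W_z = e^{-ih\otimes\hat\sigma_z}$, i.e. in $2\times 2$ block form with respect to the qubit, $W_z=\begin{bmatrix}\omega & 0\\ 0&\omega^{-1}\end{bmatrix}$. Let $d$ be a positive integer. (Forward direction.) For every $\vec\theta=(\theta_0,\dots,\theta_d)\in\mathbb{R}^{d+1}$, the operator $$Q_{\vec\theta}(\omega) = e^{i\theta_d\hat\sigma_x}\, W_z e^{i\theta_{d-1}\hat\sigma_x}\, W_z e^{i\theta_{d-2}\hat\sigma_x}\cdots W_z e^{i\theta_0\hat\sigma_x}$$ (with $d$ factors $W_z$) has the block form $$Q_{\vec\theta}(\omega)=\begin{bmatrix} F(\omega) & iG(\omega)\\ iG(1/\omega) & F(1/\omega)\end{bmatrix},$$ where $$F(\omega)=\sum_{n} f_n\omega^n=\sum_n f_n e^{-ihn},\qquad G(\omega)=\sum_{n} g_n\omega^n=\sum_n g_n e^{-ihn},$$ the sums run over $n\in\{-d,-d+2,-d+4,\dots,d\}$, the coefficients $f_n,g_n$ are real, and $F(\omega)F(1/\omega)+G(\omega)G(1/\omega)=1$. (Converse direction.) Given a Laurent polynomial $F(\omega)=\sum_{n\in\{-d,-d+2,\dots,d\}}f_n\omega^n$ with real coefficients $f_n$ such that $F(\omega)F(1/\omega)<1$ for all complex $\omega$ with $|\omega|=1$, there exists $\vec\theta=(\theta_0,\dots,\theta_d)\in\mathbb{R}^{d+1}$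 such that the operator $Q_{\vec\theta}(\omega) = e^{i\theta_d\hat\sigma_x}\, W_z e^{i\theta_{d-1}\hat\sigma_x}\, W_z e^{i\theta_{d-2}\hat\sigma_x}\cdots W_z e^{i\theta_0\hat\sigma_x}$ (with $d$ factors $W_z$) block-encodes $F(\omega)$, i.e. its upper-left block equals $F(\omega)$.
   Context: The system is a qubit coupled to a bosonic oscillator, with Hilbert space $\mathbb{C}^2\otimes L^2(\mathbb{R})$. Operators on it are written as $2\times2$ block matrices (indexed by the qubit's computational basis) with entries operators on $L^2(\mathbb{R})$. $\hat x$ and $\hat p$ are the canonical position and momentum operators ($[\hat x,\hat p]=i$). $\hat\sigma_x=\begin{bmatrix}0&1\\1&0\end{bmatrix}$ and $\hat\sigma_z=\begin{bmatrix}1&0\\0&-1\end{bmatrix}$ are Pauli matrices on the qubit; $e^{i\theta\hat\sigma_x}$ acts as the identity on the oscillator. $1/\omega$ denotes $\omega^{-1}=e^{ih}$. Functions of $h$ are defined by functional calculus. *)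

theory Defs
  imports "HOL-Analysis.Analysis" "HOL-Library.Complex_Order"
begin

section \<open>Complex inner product spaces\<close>

text \<open>
  The inner product is conjugate-linear in the first and linear in the second argument. Its real
  part is the inner product of the underlying real space, so norm and topology come from
  \<^class>\<open>real_inner\<close>.
\<close>

class complex_inner = real_inner +
  fixes scaleC :: "complex \<Rightarrow> 'a \<Rightarrow> 'a"  (infixr \<open>*\<^sub>C\<close> 75)
    and cinner :: "'a \<Rightarrow> 'a \<Rightarrow> complex"
  assumes scaleC_add_right: "a *\<^sub>C (x + y) = a *\<^sub>C x + a *\<^sub>C y"
    and scaleC_add_left: "(a + b) *\<^sub>C x = a *\<^sub>C x + b *\<^sub>C x"
    and scaleC_scaleC: "a *\<^sub>C b *\<^sub>C x = (a * b) *\<^sub>C x"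
    and scaleR_scaleC: "r *\<^sub>R x = complex_of_real r *\<^sub>C x"
    and cinner_commute: "cinner x y = cnj (cinner y x)"
    and cinner_add_right: "cinner x (y + z) = cinner x y + cinner x z"
    and cinner_scaleC_right: "cinner x (a *\<^sub>C y) = a * cinner x y"
    and inner_Re_cinner: "inner x y = Re (cinner x y)"

instantiation prod :: (complex_inner, complex_inner) complex_inner
begin

definition scaleC_prod_def: "a *\<^sub>C x = (a *\<^sub>C fst x, a *\<^sub>C snd x)"

definition cinner_prod_def: "cinner x y = cinner (fst x) (fst y) + cinner (snd x) (snd y)"

instance
proof
  fix a b :: complex and r :: real and x y z :: "'a \<times> 'b"
  show "a *\<^sub>C (x + y) = a *\<^sub>C x + a *\<^sub>C y"
    by (simp add: scaleC_prod_def scaleC_add_right)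
  show "(a + b) *\<^sub>C x = a *\<^sub>C x + b *\<^sub>C x"
    by (simp add: scaleC_prod_def scaleC_add_left)
  show "a *\<^sub>C b *\<^sub>C x = (a * b) *\<^sub>C x"
    by (simp add: scaleC_prod_def scaleC_scaleC)
  show "r *\<^sub>R x = complex_of_real r *\<^sub>C x"
    by (simp add: scaleC_prod_def scaleR_scaleC prod_eq_iff)
  show "cinner x y = cnj (cinner y x)"
    unfolding cinner_prod_def complex_cnj_add
    by (simp flip: cinner_commute)
  show "cinner x (y + z) = cinner x y + cinner x z"
    by (simp add: cinner_prod_def cinner_add_right)
  show "cinner x (a *\<^sub>C y) = a * cinner x y"
    by (simp add: cinner_prod_def scaleC_prod_def cinner_scaleC_right distrib_left)
  show "inner x y = Re (cinner x y)"
    by (simp add: cinner_prod_def inner_prod_def inner_Re_cinner)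
qed

end


section \<open>The oscillator space\<close>

definition square_integrable :: "(real \<Rightarrow> complex) \<Rightarrow> bool" where
  "square_integrable f \<longleftrightarrow>
     f \<in> borel_measurable borel \<and> integrable lborel (\<lambda>x. (cmod (f x))\<^sup>2)"

lemma square_integrable_zero: "square_integrable (\<lambda>x. 0)"
  by (simp add: square_integrable_def)

lemma square_integrable_scale: "square_integrable f \<Longrightarrow> square_integrable (\<lambda>x. a * f x)"
  by (auto simp: square_integrable_def norm_mult power_mult_distrib)

lemma square_integrable_add:
  assumes "square_integrable f" "square_integrable g"
  shows "square_integrable (\<lambda>x. f x + g x)"
proof -
  have [measurable]: "f \<in> borel_measurable borel" "g \<in> borel_measurable borel"
    using assms by (auto simp: square_integrable_def)
  have "integrable lborel (\<lambda>x. 2 * (cmod (f x))\<^sup>2 + 2 * (cmod (g x))\<^sup>2)"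
    using assms by (auto simp: square_integrable_def)
  then have "integrable lborel (\<lambda>x. (cmod (f x + g x))\<^sup>2)"
  proof (rule Bochner_Integration.integrable_bound)
    show "AE x in lborel.
        norm ((cmod (f x + g x))\<^sup>2) \<le> norm (2 * (cmod (f x))\<^sup>2 + 2 * (cmod (g x))\<^sup>2)"
    proof (rule AE_I2)
      fix x
      have "(cmod (f x + g x))\<^sup>2 \<le> (cmod (f x) + cmod (g x))\<^sup>2"
        by (intro power_mono norm_triangle_ineq) simp
      also have "\<dots> \<le> 2 * (cmod (f x))\<^sup>2 + 2 * (cmod (g x))\<^sup>2"
        using zero_le_power2[of "cmod (f x) - cmod (g x)"]
        by (simp add: power2_eq_square algebra_simps)
      finally show "norm ((cmod (f x + g x))\<^sup>2)
          \<le> norm (2 * (cmod (f x))\<^sup>2 + 2 * (cmod (g x))\<^sup>2)"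
        by simp
    qed
  qed simp
  then show ?thesis
    by (simp add: square_integrable_def)
qed

lemma square_integrable_cnj_mult:
  assumes "square_integrable f" "square_integrable g"
  shows "integrable lborel (\<lambda>x. cnj (f x) * g x)"
proof -
  have [measurable]: "f \<in> borel_measurable borel" "g \<in> borel_measurable borel"
    using assms by (auto simp: square_integrable_def)
  have "integrable lborel (\<lambda>x. (cmod (f x))\<^sup>2 + (cmod (g x))\<^sup>2)"
    using assms by (auto simp: square_integrable_def)
  then show ?thesis
  proof (rule Bochner_Integration.integrable_bound)
    show "AE x in lborel.
        norm (cnj (f x) * g x) \<le> norm ((cmod (f x))\<^sup>2 + (cmod (g x))\<^sup>2)"
    proof (rule AE_I2)
      fix x
      have "2 * (cmod (f x) * cmod (g x)) \<le> (cmod (f x))\<^sup>2 + (cmod (g x))\<^sup>2"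
        using zero_le_power2[of "cmod (f x) - cmod (g x)"]
        by (simp add: power2_eq_square algebra_simps)
      moreover have "0 \<le> cmod (f x) * cmod (g x)" by simp
      ultimately show "norm (cnj (f x) * g x) \<le> norm ((cmod (f x))\<^sup>2 + (cmod (g x))\<^sup>2)"
        unfolding norm_mult complex_mod_cnj real_norm_def by linarith
    qed
    have [measurable]: "cnj \<in> borel_measurable borel"
      by (intro borel_measurable_continuous_onI continuous_intros)
    show "(\<lambda>x. cnj (f x) * g x) \<in> borel_measurable lborel"
      by measurable
  qed
qed

quotient_type l2 = "real \<Rightarrow> complex" / partial:
  "\<lambda>f g. square_integrable f \<and> square_integrable g \<and> (AE x in lborel. f x = g x)"
proof (rule part_equivpI)
  show "\<exists>f. square_integrable f \<and> square_integrable f \<and> (AE x in lborel. f x = f x)"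
    using square_integrable_zero by auto
  show "symp (\<lambda>f g. square_integrable f \<and> square_integrable g \<and> (AE x in lborel. f x = g x))"
    by (auto simp: symp_def elim: AE_mp)
  show "transp (\<lambda>f g. square_integrable f \<and> square_integrable g \<and> (AE x in lborel. f x = g x))"
    by (auto simp: transp_def)
qed

instantiation l2 :: complex_inner
begin

lift_definition zero_l2 :: l2 is "\<lambda>x. 0"
  by (simp add: square_integrable_zero)

lift_definition plus_l2 :: "l2 \<Rightarrow> l2 \<Rightarrow> l2" is "\<lambda>f g x. f x + g x"
  by (auto simp: square_integrable_add)

lift_definition scaleC_l2 :: "complex \<Rightarrow> l2 \<Rightarrow> l2" is "\<lambda>a f x. a * f x"
  by (auto simp: square_integrable_scale)

lift_definition cinner_l2 :: "l2 \<Rightarrow> l2 \<Rightarrow> complex" is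
  "\<lambda>f g. \<integral>x. cnj (f x) * g x \<partial>lborel"
proof -
  fix f f' g g' :: "real \<Rightarrow> complex"
  assume f: "square_integrable f \<and> square_integrable f' \<and> (AE x in lborel. f x = f' x)"
    and g: "square_integrable g \<and> square_integrable g' \<and> (AE x in lborel. g x = g' x)"
  show "(\<integral>x. cnj (f x) * g x \<partial>lborel) = (\<integral>x. cnj (f' x) * g' x \<partial>lborel)"
  proof (rule integral_cong_AE)
    show "(\<lambda>x. cnj (f x) * g x) \<in> borel_measurable lborel"
      using f g by (intro borel_measurable_integrable square_integrable_cnj_mult) auto
    show "(\<lambda>x. cnj (f' x) * g' x) \<in> borel_measurable lborel"
      using f g by (intro borel_measurable_integrable square_integrable_cnj_mult) auto
    show "AE x in lborel. cnj (f x) * g x = cnj (f' x) * g' x"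
      using f g by auto
  qed
qed

definition uminus_l2_def: "- (\<psi>::l2) = (-1) *\<^sub>C \<psi>"
definition minus_l2_def: "(\<phi>::l2) - \<psi> = \<phi> + (- \<psi>)"
definition scaleR_l2_def: "r *\<^sub>R (\<psi>::l2) = complex_of_real r *\<^sub>C \<psi>"
definition inner_l2_def: "inner (\<phi>::l2) \<psi> = Re (cinner \<phi> \<psi>)"
definition norm_l2_def: "norm (\<psi>::l2) = sqrt (inner \<psi> \<psi>)"
definition sgn_l2_def: "sgn (\<psi>::l2) = inverse (norm \<psi>) *\<^sub>R \<psi>"
definition dist_l2_def: "dist (\<phi>::l2) \<psi> = norm (\<phi> - \<psi>)"
definition uniformity_l2_def [code del]:
  "(uniformity :: (l2 \<times> l2) filter) = (INF e\<in>{0<..}. principal {(\<phi>, \<psi>). dist \<phi> \<psi> < e})"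
definition open_l2_def [code del]:
  "open (U :: l2 set) \<longleftrightarrow> (\<forall>\<phi>\<in>U. eventually (\<lambda>(\<phi>', \<psi>). \<phi>' = \<phi> \<longrightarrow> \<psi> \<in> U) uniformity)"

instance
proof
  fix a b :: complex and r s :: real and x y z :: l2
  show "x + y + z = x + (y + z)"
    by transfer (auto simp: square_integrable_add add.assoc)
  show "x + y = y + x" for x y :: l2
    by transfer (auto simp: square_integrable_add add.commute)
  show zero: "0 + x = x" for x :: l2
    by transfer auto
  show "- x + x = 0"
    unfolding uminus_l2_def
    by transfer (auto simp: square_integrable_zero
        intro: square_integrable_add[OF square_integrable_scale[where a = "-1"], simplified])
  show "x - y = x + - y"
    by (rule minus_l2_def)
  show addr: "a *\<^sub>C (x + y) = a *\<^sub>C x + a *\<^sub>C y" for a and x y :: l2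
    by transfer (auto simp: square_integrable_add square_integrable_scale distrib_left)
  show addl: "(a + b) *\<^sub>C x = a *\<^sub>C x + b *\<^sub>C x" for a b and x :: l2
    by transfer (auto simp: square_integrable_add square_integrable_scale distrib_right)
  show assoc: "a *\<^sub>C b *\<^sub>C x = (a * b) *\<^sub>C x" for a b and x :: l2
    by transfer (auto simp: square_integrable_scale mult.assoc)
  show "r *\<^sub>R x = complex_of_real r *\<^sub>C x"
    by (rule scaleR_l2_def)
  show "r *\<^sub>R (x + y) = r *\<^sub>R x + r *\<^sub>R y"
    by (simp add: scaleR_l2_def addr)
  show "(r + s) *\<^sub>R x = r *\<^sub>R x + s *\<^sub>R x"
    by (simp add: scaleR_l2_def addl)
  show "r *\<^sub>R s *\<^sub>R x = (r * s) *\<^sub>R x"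
    by (simp add: scaleR_l2_def assoc)
  show "1 *\<^sub>R x = x"
    unfolding scaleR_l2_def by transfer auto
  show cc: "cinner x y = cnj (cinner y x)" for x y :: l2
    by transfer (simp flip: Bochner_Integration.integral_cnj add: mult.commute)
  show ca: "cinner x (y + z) = cinner x y + cinner x z" for x y z :: l2
    by transfer (simp add: distrib_left square_integrable_cnj_mult)
  show cs: "cinner x (a *\<^sub>C y) = a * cinner x y" for a and x y :: l2
    by transfer (simp add: mult.left_commute)
  show "inner x y = Re (cinner x y)"
    by (rule inner_l2_def)
  show ic: "inner x y = inner y x" for x y :: l2
    by (metis inner_l2_def cc complex_cnj(1) cnj.sel(1))
  show "inner (x + y) z = inner x z + inner y z"
    by (simp add: ic[of _ z]) (simp add: inner_l2_def ca)
  show "inner (r *\<^sub>R x) y = r * inner x y"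
    by (simp add: ic[of _ y]) (simp add: inner_l2_def scaleR_l2_def cs)
  have sq: "cinner x x = complex_of_real (\<integral>t. (cmod (rep_l2 x t))\<^sup>2 \<partial>lborel)" for x :: l2
    unfolding cinner_l2.rep_eq integral_complex_of_real[symmetric] complex_norm_square
    by (simp add: mult.commute)
  show "0 \<le> inner x x"
    by (simp add: inner_l2_def sq)
  show "(inner x x = 0) = (x = 0)"
  proof
    have "cinner 0 (0 :: l2) = 0"
      using ca[of 0 0 0] unfolding zero by simp
    then show "inner x x = 0" if "x = 0"
      using that by (simp add: inner_l2_def)
    show "x = 0" if "inner x x = 0"
    proof -
      have "cinner x x = 0"
        using that by (simp add: inner_l2_def sq)
      then show ?thesis
      proof transfer
        fix f :: "real \<Rightarrow> complex"
        assume f: "square_integrable f \<and> square_integrable f \<and> (AE x in lborel. f x = f x)"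
          and 0: "(\<integral>x. cnj (f x) * f x \<partial>lborel) = 0"
        have "complex_of_real (\<integral>x. (cmod (f x))\<^sup>2 \<partial>lborel) = (\<integral>x. cnj (f x) * f x \<partial>lborel)"
          unfolding integral_complex_of_real[symmetric] complex_norm_square
          by (simp add: mult.commute)
        then have "(\<integral>x. (cmod (f x))\<^sup>2 \<partial>lborel) = 0"
          using 0 by simp
        then have "AE x in lborel. (cmod (f x))\<^sup>2 = 0"
          using f by (subst (asm) integral_nonneg_eq_0_iff_AE) (auto simp: square_integrable_def)
        then show "square_integrable f \<and> square_integrable (\<lambda>x. 0) \<and> (AE x in lborel. f x = 0)"
          using f by (auto simp: square_integrable_zero)
      qed
    qed
  qed
  show "norm x = sqrt (inner x x)"
    by (rule norm_l2_def)
  show "sgn x = inverse (norm x) *\<^sub>R x"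
    by (rule sgn_l2_def)
  show "dist x y = norm (x - y)"
    by (rule dist_l2_def)
  show "(uniformity :: (l2 \<times> l2) filter) = (INF e\<in>{0<..}. principal {(\<phi>, \<psi>). dist \<phi> \<psi> < e})"
    by (rule uniformity_l2_def)
  show "open U \<longleftrightarrow> (\<forall>\<phi>\<in>U. eventually (\<lambda>(\<phi>', \<psi>). \<phi>' = \<phi> \<longrightarrow> \<psi> \<in> U) uniformity)" for U :: "l2 set"
    by (rule open_l2_def)
qed

end


section \<open>Unbounded operators and functional calculus\<close>

text \<open>An operator is given by its graph; its domain is \<^const>\<open>Domain\<close> of the graph.\<close>

type_synonym 'a operator = "('a \<times> 'a) set"

definition op_graph :: "('a \<Rightarrow> 'a) \<Rightarrow> 'a operator" where
  "op_graph A = range (\<lambda>\<psi>. (\<psi>, A \<psi>))"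

definition linear_operator :: "'a::complex_inner operator \<Rightarrow> bool" where
  "linear_operator T \<longleftrightarrow> single_valued T \<and> (0, 0) \<in> T \<and>
     (\<forall>x\<in>T. \<forall>y\<in>T. x + y \<in> T) \<and> (\<forall>a. \<forall>x\<in>T. a *\<^sub>C x \<in> T)"

definition adjoint_op :: "'a::complex_inner operator \<Rightarrow> 'a operator" where
  "adjoint_op T = {(\<phi>, \<eta>). \<forall>(\<psi>, \<xi>)\<in>T. cinner \<phi> \<xi> = cinner \<eta> \<psi>}"

definition self_adjoint :: "'a::complex_inner operator \<Rightarrow> bool" where
  "self_adjoint T \<longleftrightarrow> linear_operator T \<and> closure (Domain T) = UNIV \<and> adjoint_op T = T"

definition clinear_map :: "('a::complex_inner \<Rightarrow> 'a) \<Rightarrow> bool" where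
  "clinear_map A \<longleftrightarrow>
     (\<forall>\<phi> \<psi>. A (\<phi> + \<psi>) = A \<phi> + A \<psi>) \<and> (\<forall>a \<psi>. A (a *\<^sub>C \<psi>) = a *\<^sub>C A \<psi>)"

definition unitary :: "('a::complex_inner \<Rightarrow> 'a) \<Rightarrow> bool" where
  "unitary A \<longleftrightarrow> clinear_map A \<and> surj A \<and> (\<forall>\<phi> \<psi>. cinner (A \<phi>) (A \<psi>) = cinner \<phi> \<psi>)"

definition orth_projection :: "('a::complex_inner \<Rightarrow> 'a) \<Rightarrow> bool" where
  "orth_projection P \<longleftrightarrow> clinear_map P \<and> P \<circ> P = P \<and> (\<forall>\<phi> \<psi>. cinner \<phi> (P \<psi>) = cinner (P \<phi>) \<psi>)"

definition projection_valued_measure :: "(real set \<Rightarrow> 'a::complex_inner \<Rightarrow> 'a) \<Rightarrow> bool" where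
  "projection_valued_measure E \<longleftrightarrow>
     (\<forall>B\<in>sets borel. orth_projection (E B)) \<and>
     E {} = (\<lambda>\<psi>. 0) \<and> E UNIV = id \<and>
     (\<forall>B\<in>sets borel. \<forall>C\<in>sets borel. E (B \<inter> C) = E B \<circ> E C) \<and>
     (\<forall>A :: nat \<Rightarrow> real set. range A \<subseteq> sets borel \<longrightarrow> disjoint_family A \<longrightarrow>
        (\<forall>\<psi>. (\<lambda>n. E (A n) \<psi>) sums E (\<Union>n. A n) \<psi>))"

definition spectral_dist :: "(real set \<Rightarrow> 'a::complex_inner \<Rightarrow> 'a) \<Rightarrow> 'a \<Rightarrow> real measure" where
  "spectral_dist E \<psi> = measure_of UNIV (sets borel) (\<lambda>B. ennreal (Re (cinner \<psi> (E B \<psi>))))"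

text \<open>
  The integral of \<open>f\<close> against the complex measure \<open>B \<mapsto> cinner \<eta> (E B \<psi>)\<close>, written by polarization
  as a combination of integrals against the positive measures \<^const>\<open>spectral_dist\<close>.
\<close>

definition spectral_form ::
    "(real set \<Rightarrow> 'a::complex_inner \<Rightarrow> 'a) \<Rightarrow> (real \<Rightarrow> complex) \<Rightarrow> 'a \<Rightarrow> 'a \<Rightarrow> complex" where
  "spectral_form E f \<eta> \<psi> =
     (\<Sum>k<4. \<i> ^ k * (\<integral>t. f t \<partial>spectral_dist E (\<psi> + \<i> ^ k *\<^sub>C \<eta>))) / 4"

definition spectral_domain ::
    "(real set \<Rightarrow> 'a::complex_inner \<Rightarrow> 'a) \<Rightarrow> (real \<Rightarrow> complex) \<Rightarrow> 'a set" where
  "spectral_domain E f = {\<psi>. integrable (spectral_dist E \<psi>) (\<lambda>t. (cmod (f t))\<^sup>2)}"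

text \<open>
  The operator \<open>\<integral> f dE\<close>. The vector \<open>\<phi>\<close> below is unique because the domain is dense
  for every Borel function \<open>f\<close>.
\<close>

definition spectral_integral ::
    "(real set \<Rightarrow> 'a::complex_inner \<Rightarrow> 'a) \<Rightarrow> (real \<Rightarrow> complex) \<Rightarrow> 'a operator" where
  "spectral_integral E f =
     {(\<psi>, \<phi>). \<psi> \<in> spectral_domain E f \<and>
        (\<forall>\<eta>\<in>spectral_domain E f. cinner \<eta> \<phi> = spectral_form E f \<eta> \<psi>)}"

definition spectral_measure_of ::
    "'a::complex_inner operator \<Rightarrow> (real set \<Rightarrow> 'a \<Rightarrow> 'a) \<Rightarrow> bool" where
  "spectral_measure_of T E \<longleftrightarrow>
     projection_valued_measure E \<and> spectral_integral E complex_of_real = T"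

text \<open>
  The operator \<open>f(T)\<close>. By the spectral theorem a self-adjoint \<open>T\<close> on a Hilbert space has exactly
  one spectral measure (on Borel sets), so that the union is over a single \<open>E\<close>.
\<close>

definition fun_calc :: "'a::complex_inner operator \<Rightarrow> (real \<Rightarrow> complex) \<Rightarrow> 'a operator" where
  "fun_calc T f = (\<Union>E\<in>{E. spectral_measure_of T E}. spectral_integral E f)"


section \<open>Analytic functions of position and momentum\<close>

definition real_analytic2 :: "(real \<Rightarrow> real \<Rightarrow> complex) \<Rightarrow> bool" where
  "real_analytic2 s \<longleftrightarrow>
     (\<forall>a b. \<exists>r>0. \<exists>c :: nat \<Rightarrow> nat \<Rightarrow> complex. \<forall>x p. \<bar>x - a\<bar> < r \<longrightarrow> \<bar>p - b\<bar> < r \<longrightarrow>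
        ((\<lambda>(j, k). c j k * complex_of_real ((x - a) ^ j * (p - b) ^ k)) has_sum s x p) UNIV)"

definition fourier :: "(real \<Rightarrow> complex) \<Rightarrow> real \<Rightarrow> complex" where
  "fourier f p = (\<integral>x. exp (- (\<i> * of_real (p * x))) * f x \<partial>lborel) / of_real (sqrt (2 * pi))"

text \<open>
  The operator \<open>s(x, p)\<close>, with all position operators to the left of all momentum operators
  (every polynomial in the two can be brought into this order by \<open>[x, p] = i\<close>). The position
  operator multiplies by \<open>x\<close>, and the momentum operator \<open>- i d/dx\<close> multiplies \<open>exp (i x p)\<close>
  by \<open>p\<close>, so that applying \<open>s(x, p)\<close> to the Fourier inversion formula for \<open>f\<close> gives the integral below.
  In particular \<open>s x p = x\<close> is position and \<open>s x p = p\<close> is momentum.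
\<close>

definition quadrature_operator :: "(real \<Rightarrow> real \<Rightarrow> complex) \<Rightarrow> l2 operator" where
  "quadrature_operator s = {(\<psi>, \<phi>). \<exists>f g.
     square_integrable f \<and> square_integrable g \<and> \<psi> = abs_l2 f \<and> \<phi> = abs_l2 g \<and>
     integrable lborel f \<and>
     (AE x in lborel.
        integrable lborel (\<lambda>p. s x p * exp (\<i> * of_real (x * p)) * fourier f p) \<and>
        g x = (\<integral>p. s x p * exp (\<i> * of_real (x * p)) * fourier f p \<partial>lborel)
                / of_real (sqrt (2 * pi)))}"

text \<open>
  \<open>h = s(x, p)\<close> for some analytic \<open>s\<close>, where equality of unbounded operators means that \<open>h\<close> is
  the closure of its restriction to vectors on which it is given by the formula above.
\<close>

definition analytic_in_quadratures :: "l2 operator \<Rightarrow> bool" where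
  "analytic_in_quadratures h \<longleftrightarrow>
     (\<exists>s. real_analytic2 s \<and> h \<subseteq> closure (h \<inter> quadrature_operator s))"


section \<open>A qubit coupled to the oscillator\<close>

text \<open>The space \<open>\<complex>\<^sup>2 \<otimes> H\<close> is \<open>H \<times> H\<close>, indexed by the computational basis of the qubit.\<close>

definition block ::
    "('a \<Rightarrow> 'a) \<Rightarrow> ('a \<Rightarrow> 'a) \<Rightarrow> ('a \<Rightarrow> 'a) \<Rightarrow> ('a \<Rightarrow> 'a) \<Rightarrow> 'a \<times> 'a \<Rightarrow> 'a::complex_inner \<times> 'a" where
  "block A B C D = (\<lambda>(u, v). (A u + B v, C u + D v))"

definition upper_left :: "('a::complex_inner \<times> 'a \<Rightarrow> 'a \<times> 'a) \<Rightarrow> 'a \<Rightarrow> 'a" where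
  "upper_left T u = fst (T (u, 0))"

definition pauli_x :: "complex^2^2" where
  "pauli_x = vector [vector [0, 1], vector [1, 0]]"

definition pauli_z :: "complex^2^2" where
  "pauli_z = vector [vector [1, 0], vector [0, -1]]"

definition matrix_exp :: "complex^2^2 \<Rightarrow> complex^2^2" where
  "matrix_exp M = (\<Sum>k. ((**) M ^^ k) (mat 1) /\<^sub>R fact k)"

text \<open>\<open>M \<otimes> 1\<close> for a \<open>2 \<times> 2\<close> matrix \<open>M\<close>\<close>

definition qubit_gate :: "complex^2^2 \<Rightarrow> 'a \<times> 'a \<Rightarrow> 'a::complex_inner \<times> 'a" where
  "qubit_gate M = block (scaleC (M $ 1 $ 1)) (scaleC (M $ 1 $ 2))
                        (scaleC (M $ 2 $ 1)) (scaleC (M $ 2 $ 2))"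

text \<open>\<open>T \<otimes> M\<close> for an operator \<open>T\<close> on the oscillator and a \<open>2 \<times> 2\<close> matrix \<open>M\<close> on the qubit\<close>

definition qubit_tensor :: "'a::complex_inner operator \<Rightarrow> complex^2^2 \<Rightarrow> ('a \<times> 'a) operator" where
  "qubit_tensor T M =
     {((u, v), qubit_gate M (u', v')) | u v u' v'. (u, u') \<in> T \<and> (v, v') \<in> T}"

definition x_rotation :: "real \<Rightarrow> 'a \<times> 'a \<Rightarrow> 'a::complex_inner \<times> 'a" where
  "x_rotation \<theta> = qubit_gate (matrix_exp (map_matrix ((*) (\<i> * of_real \<theta>)) pauli_x))"

primrec qsp :: "('a \<times> 'a \<Rightarrow> 'a \<times> 'a) \<Rightarrow> (nat \<Rightarrow> real) \<Rightarrow> nat \<Rightarrow> 'a \<times> 'a \<Rightarrow> 'a::complex_inner \<times> 'a" where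
  "qsp W \<theta> 0 = x_rotation (\<theta> 0)"
| "qsp W \<theta> (Suc k) = x_rotation (\<theta> (Suc k)) \<circ> W \<circ> qsp W \<theta> k"


section \<open>Laurent polynomials\<close>

text \<open>The exponents \<open>- d, - d + 2, \<dots>, d\<close>\<close>

definition laurent_exponents :: "nat \<Rightarrow> int set" where
  "laurent_exponents d = (\<lambda>k. 2 * int k - int d) ` {0..d}"

definition laurent_eval :: "nat \<Rightarrow> (int \<Rightarrow> real) \<Rightarrow> complex \<Rightarrow> complex" where
  "laurent_eval d f z = (\<Sum>n\<in>laurent_exponents d. of_real (f n) * z powi n)"

definition op_powi :: "('a \<Rightarrow> 'a) \<Rightarrow> int \<Rightarrow> 'a \<Rightarrow> 'a" where
  "op_powi A n = (if n \<ge> 0 then A ^^ nat n else inv A ^^ nat (- n))"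

definition laurent_op :: "nat \<Rightarrow> (int \<Rightarrow> real) \<Rightarrow> ('a \<Rightarrow> 'a) \<Rightarrow> 'a \<Rightarrow> 'a::complex_inner" where
  "laurent_op d f A \<psi> = (\<Sum>n\<in>laurent_exponents d. of_real (f n) *\<^sub>C op_powi A n \<psi>)"

end

theory Submission
  imports Defs "HOL-Computational_Algebra.Fundamental_Theorem_Algebra"
begin

text \<open>
  Any spectral measure \<open>E\<close> of \<open>h\<close> gives a multiplicative calculus of bounded Borel functions, in which
  \<open>\<omega>\<close> is the operator of \<open>exp (- i t)\<close> and \<open>B \<mapsto> E B \<oplus> E (- B)\<close> is a spectral measure of
  \<open>h \<otimes> \<sigma>\<^sub>z\<close>. Everything thereby reduces to identities between scalar Laurent polynomials on the unit
  circle. For the converse, \<open>1 - F(z) F(1/z)\<close> is a real polynomial in \<open>z\<^sup>2 + z\<^sup>-\<^sup>2\<close> that is positive on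
  \<open>[-2, 2]\<close>, so a Fejer-Riesz factorization over the reals supplies \<open>G\<close>. Comparing the extreme
  coefficients of \<open>F(z) F(1/z) + G(z) G(1/z) = 1\<close> yields an angle whose rotation, when undone, lowers
  the degree by one.
\<close>

text \<open>The definitions provide a form rather than an operator: \<open>spectral_form\<close> is
  assembled from four positive measures that depend quadratically on the vectors, so neither
  linearity in a vector nor multiplicativity in the function can be read off. Both follow from the
  axioms of a projection-valued measure when the function is an indicator, and pass to bounded Borel
  functions along linear combinations and uniform limits, since the form is controlled by the
  supremum of the function. An unbounded integrand appears only where
  \<open>h \<otimes> \<sigma>\<^sub>z\<close> itself is identified, and there domains have to be
  tracked.

  In the converse, G must have real coefficients and exponents of the same parity as F. The variable
  \<open>w = z\<^sup>2\<close> builds in the parity, and reality is kept by factoring a real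
  polynomial in \<open>w + 1 / w\<close>, whose values at unit w fill \<open>[-2, 2]\<close>. The
  strict inequality excludes roots in that interval, so each real root is \<open>b + 1 / b\<close>
  with b real, and the remaining roots come in conjugate pairs.\<close>

lemma cinner_add_left: "cinner (x + y) z = cinner x z + cinner y z"
  by (metis cinner_add_right cinner_commute complex_cnj_add)

lemma cinner_scaleC_left: "cinner (a *\<^sub>C x) y = cnj a * cinner x y"
  by (metis cinner_commute cinner_scaleC_right complex_cnj_mult)

lemma scaleC_one [simp]: "1 *\<^sub>C (x :: 'a::complex_inner) = x"
  using scaleR_scaleC[of 1 x] by simp

lemma scaleC_minus_one: "(-1) *\<^sub>C (x :: 'a::complex_inner) = - x"
  using scaleR_scaleC[of "-1" x] by simp

lemma scaleC_zero_left [simp]: "0 *\<^sub>C (x :: 'a::complex_inner) = 0"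
  using scaleR_scaleC[of 0 x] by simp

lemma scaleC_zero_right [simp]: "a *\<^sub>C (0 :: 'a::complex_inner) = 0"
  using scaleC_add_right[of a 0 "0 :: 'a"] by simp

lemma cinner_minus_right: "cinner x (- y) = - cinner x y"
  using cinner_scaleC_right[of x "-1" y] by (simp add: scaleC_minus_one)

lemma cinner_diff_right: "cinner x (y - z) = cinner x y - cinner x z"
  using cinner_add_right[of x y "- z"] by (simp add: cinner_minus_right)

lemma cinner_zero_right [simp]: "cinner x 0 = 0"
  using cinner_add_right[of x 0 0] by simp

lemma cinner_zero_left [simp]: "cinner 0 x = 0"
  using cinner_add_left[of 0 0 x] by simp

lemma cinner_self: "cinner x x = complex_of_real ((norm x)\<^sup>2)"
proof (rule complex_eqI)
  show "Re (cinner x x) = Re (complex_of_real ((norm x)\<^sup>2))"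
    by (simp add: power2_norm_eq_inner inner_Re_cinner)
  show "Im (cinner x x) = Im (complex_of_real ((norm x)\<^sup>2))"
    using arg_cong[OF cinner_commute[of x x], of Im] by simp
qed

lemma cinner_eqI:
  assumes "\<And>\<eta>. cinner \<eta> \<phi> = cinner \<eta> \<phi>'"
  shows "\<phi> = \<phi>'"
  using assms[of "\<phi> - \<phi>'"] cinner_self[of "\<phi> - \<phi>'"] by (simp add: cinner_diff_right)

lemma norm_scaleC: "norm (a *\<^sub>C x) = cmod a * norm (x :: 'a::complex_inner)"
proof -
  have "(norm (a *\<^sub>C x))\<^sup>2 = Re (cinner (a *\<^sub>C x) (a *\<^sub>C x))"
    by (simp add: cinner_self)
  also have "\<dots> = Re ((a * cnj a) * cinner x x)"
    by (simp only: cinner_scaleC_left cinner_scaleC_right ac_simps)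
  also have "\<dots> = (cmod a * norm x)\<^sup>2"
    unfolding complex_norm_square[symmetric] cinner_self
    by (simp add: power_mult_distrib flip: of_real_power of_real_mult)
  finally have "(norm (a *\<^sub>C x))\<^sup>2 = (cmod a * norm x)\<^sup>2" .
  then show ?thesis
    by (simp add: power2_eq_iff_nonneg)
qed

lemma cmod_cinner_le: "cmod (cinner x y) \<le> norm x * norm (y :: 'a::complex_inner)"
proof (cases "cinner x y = 0")
  case False
  \<comment> \<open>The unit scalar that makes \<open>cinner x (a *\<^sub>C y)\<close> real and
    nonnegative, so that the real Cauchy-Schwarz inequality applies.\<close>
  define a where "a = cnj (cinner x y) / cmod (cinner x y)"
  have a: "cmod a = 1"
    using False by (simp add: a_def norm_divide)
  have "a * cinner x y = (cinner x y * cnj (cinner x y)) / cmod (cinner x y)"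
    by (simp add: a_def)
  also have "\<dots> = cmod (cinner x y)"
    using False by (simp add: power2_eq_square flip: complex_norm_square)
  finally have "a * cinner x y = cmod (cinner x y)" .
  then have "cmod (cinner x y) = inner x (a *\<^sub>C y)"
    by (simp add: inner_Re_cinner cinner_scaleC_right)
  also have "\<dots> \<le> norm x * norm (a *\<^sub>C y)"
    by (rule norm_cauchy_schwarz)
  finally show ?thesis
    by (simp add: norm_scaleC a)
qed simp

lemma tendsto_cinner_right:
  assumes "(X \<longlongrightarrow> x) F"
  shows "((\<lambda>n. cinner y (X n :: 'a::complex_inner)) \<longlongrightarrow> cinner y x) F"
proof -
  have "((\<lambda>n. norm y * norm (X n - x)) \<longlongrightarrow> 0) F"
    using tendsto_mult_right_zero[OF tendsto_norm_zero[OF LIM_zero[OF assms]]] .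
  then have "((\<lambda>n. cinner y (X n) - cinner y x) \<longlongrightarrow> 0) F"
    by (rule Lim_null_comparison[rotated]) (simp add: cmod_cinner_le flip: cinner_diff_right)
  then show ?thesis
    by (rule LIM_zero_cancel)
qed

section \<open>Polarization over the fourth roots of unity\<close>

lemma sum_4: "(\<Sum>k<4. f k) = f 0 + f 1 + f 2 + f (3::nat)"
  by (simp add: eval_nat_numeral add.assoc)

lemma cinner_quadratic:
  "cinner (\<psi> + a *\<^sub>C \<eta>) (\<psi>' + a *\<^sub>C \<eta>')
    = cinner \<psi> \<psi>' + a * cinner \<psi> \<eta>' + cnj a * cinner \<eta> \<psi>' + cnj a * a * cinner \<eta> \<eta>'"
  by (simp add: cinner_add_left cinner_add_right cinner_scaleC_left cinner_scaleC_right
      algebra_simps)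

text \<open>Cross terms carry \<open>\<i> ^ k\<close> or its conjugate, and these sum to zero over a
  period. This supplies the constant in \<open>spectral_form_bound\<close>.\<close>

lemma sum_norm_polarization:
  fixes \<eta> \<psi> :: "'a::complex_inner"
  shows "(\<Sum>k<4. (norm (\<psi> + \<i> ^ k *\<^sub>C \<eta>))\<^sup>2) = 4 * ((norm \<eta>)\<^sup>2 + (norm \<psi>)\<^sup>2)"
proof -
  have "complex_of_real (\<Sum>k<4. (norm (\<psi> + \<i> ^ k *\<^sub>C \<eta>))\<^sup>2)
      = (\<Sum>k<4. cinner (\<psi> + \<i> ^ k *\<^sub>C \<eta>) (\<psi> + \<i> ^ k *\<^sub>C \<eta>))"
    by (simp only: cinner_self of_real_sum)
  also have "\<dots> = 4 * (cinner \<eta> \<eta> + cinner \<psi> \<psi>)"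
    unfolding cinner_quadratic by (simp add: sum_4 power3_eq_cube)
  also have "\<dots> = complex_of_real (4 * ((norm \<eta>)\<^sup>2 + (norm \<psi>)\<^sup>2))"
    by (simp add: cinner_self)
  finally show ?thesis
    by (simp only: of_real_eq_iff)
qed

lemma orth_projection_norm:
  assumes "orth_projection P"
  shows "cinner \<psi> (P \<psi>) = complex_of_real ((norm (P \<psi>))\<^sup>2)"
proof -
  have "cinner \<psi> (P \<psi>) = cinner \<psi> (P (P \<psi>))"
    using assms by (simp add: orth_projection_def comp_def fun_eq_iff)
  then show ?thesis
    using assms by (simp add: orth_projection_def cinner_self)
qed

lemma clinear_map_add: "clinear_map A \<Longrightarrow> A (\<phi> + \<psi>) = A \<phi> + A \<psi>"
  and clinear_map_scaleC: "clinear_map A \<Longrightarrow> A (a *\<^sub>C \<psi>) = a *\<^sub>C A \<psi>"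
  by (auto simp: clinear_map_def)

text \<open>Under the weight \<open>\<i> ^ k\<close> only the term with coefficient
  \<open>cnj (\<i> ^ k)\<close> survives the summation. This evaluates \<open>spectral_form\<close>
  on indicators.\<close>

lemma orth_projection_polarization:
  assumes "orth_projection P"
  shows "(\<Sum>k<4. \<i> ^ k * complex_of_real ((norm (P (\<psi> + \<i> ^ k *\<^sub>C \<eta>)))\<^sup>2)) / 4 = cinner \<eta> (P \<psi>)"
proof -
  have P: "P (\<psi> + a *\<^sub>C \<eta>) = P \<psi> + a *\<^sub>C P \<eta>" for a
    using assms by (simp add: orth_projection_def clinear_map_def)
  have "(\<Sum>k<4. \<i> ^ k * cinner (\<psi> + \<i> ^ k *\<^sub>C \<eta>) (P (\<psi> + \<i> ^ k *\<^sub>C \<eta>))) = 4 * cinner \<eta> (P \<psi>)"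
    unfolding P cinner_quadratic by (simp add: sum_4 power3_eq_cube algebra_simps)
  then show ?thesis
    by (simp only: orth_projection_norm[OF assms]) simp
qed

lemma inverse_eq_cnj: "cmod z = 1 \<Longrightarrow> inverse z = cnj z"
  using complex_norm_square[of z] by (intro inverse_unique) simp

section \<open>Bounded Borel functions\<close>

definition bounded_borel :: "(real \<Rightarrow> complex) \<Rightarrow> bool" where
  "bounded_borel f \<longleftrightarrow> f \<in> borel_measurable borel \<and> bounded (range f)"

lemma bounded_borel_measurable: "bounded_borel f \<Longrightarrow> f \<in> borel_measurable borel"
  by (simp add: bounded_borel_def)

lemma bounded_borelE:
  assumes "bounded_borel f"
  obtains K where "K > 0" "\<And>t. cmod (f t) \<le> K"
  using assms unfolding bounded_borel_def bounded_pos by auto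

lemma bounded_borelI:
  assumes "f \<in> borel_measurable borel" "\<And>t. cmod (f t) \<le> K"
  shows "bounded_borel f"
  using assms by (auto simp: bounded_borel_def bounded_iff)

lemma bounded_borel_indicator: "B \<in> sets borel \<Longrightarrow> bounded_borel (indicator B)"
  by (rule bounded_borelI[where K = 1]) (auto simp: indicator_def)

lemma bounded_borel_const: "bounded_borel (\<lambda>t. a)"
  by (rule bounded_borelI[where K = "cmod a"]) auto

lemma bounded_borel_add:
  assumes "bounded_borel f" "bounded_borel g"
  shows "bounded_borel (\<lambda>t. f t + g t)"
proof -
  obtain K L where K: "cmod (f t) \<le> K" and L: "cmod (g t) \<le> L" for t
    using assms by (meson bounded_borelE)
  show ?thesis
    by (rule bounded_borelI[where K = "K + L"])
      (use assms in \<open>auto intro: norm_triangle_mono K L simp: bounded_borel_def\<close>)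
qed

lemma bounded_borel_mult:
  assumes "bounded_borel f" "bounded_borel g"
  shows "bounded_borel (\<lambda>t. f t * g t)"
proof -
  obtain K L where K: "cmod (f t) \<le> K" "K > 0" and L: "cmod (g t) \<le> L" for t
    using assms by (meson bounded_borelE)
  have "cmod (f t * g t) \<le> K * L" for t
    unfolding norm_mult using K L[of t] by (intro mult_mono) auto
  then show ?thesis
    using assms by (intro bounded_borelI[where K = "K * L"]) (auto simp: bounded_borel_def)
qed

lemma bounded_borel_scale: "bounded_borel f \<Longrightarrow> bounded_borel (\<lambda>t. a * f t)"
  by (intro bounded_borel_mult bounded_borel_const)

lemma bounded_borel_sum: "(\<And>i. i \<in> I \<Longrightarrow> bounded_borel (f i)) \<Longrightarrow> bounded_borel (\<lambda>t. \<Sum>i\<in>I. f i t)"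
  by (induction I rule: infinite_finite_induct) (auto intro: bounded_borel_const bounded_borel_add)

lemma bounded_borel_cnj:
  assumes "bounded_borel f"
  shows "bounded_borel (\<lambda>t. cnj (f t))"
proof -
  obtain K where "cmod (f t) \<le> K" for t
    using assms by (meson bounded_borelE)
  moreover have "cnj \<in> borel_measurable borel"
    by (intro borel_measurable_continuous_onI continuous_intros)
  ultimately show ?thesis
    using assms by (intro bounded_borelI[where K = K]) (auto simp: bounded_borel_def)
qed

text \<open>Limits are uniform here, in contrast to the monotone limits of the usual measurable
  inductions, because convergence of \<open>spectral_form\<close> is obtained from a supremum
  bound.\<close>

lemma bounded_borel_induct [consumes 1, case_names indicator add scale lim]:
  assumes f: "bounded_borel f"
    and ind: "\<And>B. B \<in> sets borel \<Longrightarrow> P (indicator B)"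
    and add: "\<And>f g. bounded_borel f \<Longrightarrow> bounded_borel g \<Longrightarrow> P f \<Longrightarrow> P g \<Longrightarrow> P (\<lambda>t. f t + g t)"
    and scale: "\<And>a f. bounded_borel f \<Longrightarrow> P f \<Longrightarrow> P (\<lambda>t. a * f t)"
    and lim: "\<And>F f. (\<And>n. bounded_borel (F n)) \<Longrightarrow> (\<And>n. P (F n)) \<Longrightarrow> bounded_borel f \<Longrightarrow>
      uniform_limit UNIV F f sequentially \<Longrightarrow> P f"
  shows "P f"
proof -
  have [measurable]: "f \<in> borel_measurable borel"
    using f by (rule bounded_borel_measurable)
  obtain K where K: "cmod (f t) \<le> K" "K > 0" for t
    using f by (meson bounded_borelE)
  \<comment> \<open>Rounding down to a grid of spacing \<open>1 / real (Suc n)\<close>: the error is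
    uniform in x, and boundedness of f leaves only finitely many values.\<close>
  define r where "r n x = real_of_int \<lfloor>real (Suc n) * x\<rfloor> / real (Suc n)" for n and x :: real
  have r: "\<bar>r n x - x\<bar> \<le> 1 / real (Suc n)" for n x
  proof -
    define y where "y = real (Suc n) * x"
    have x: "x = y / real (Suc n)"
      by (simp add: y_def)
    have "\<bar>r n x - x\<bar> = \<bar>real_of_int \<lfloor>y\<rfloor> - y\<bar> / real (Suc n)"
      unfolding r_def y_def[symmetric] by (subst x) (simp add: abs_divide flip: diff_divide_distrib)
    also have "\<dots> \<le> 1 / real (Suc n)"
      by (intro divide_right_mono) linarith+
    finally show ?thesis .
  qed
  define F where "F n t = Complex (r n (Re (f t))) (r n (Im (f t)))" for n t
  have F_alt: "F n = (\<lambda>t. complex_of_real (r n (Re (f t))) + \<i> * complex_of_real (r n (Im (f t))))" for n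
    by (simp add: F_def fun_eq_iff complex_eq_iff)
  have F_meas [measurable]: "F n \<in> borel_measurable borel" for n
    unfolding F_alt r_def by measurable
  have finite_range: "finite (range (F n))" for n
  proof -
    define N where "N = \<lceil>real (Suc n) * K\<rceil> + 1"
    define S where "S = (\<lambda>k. real_of_int k / real (Suc n)) ` {- N..N}"
    have "r n x \<in> S" if "\<bar>x\<bar> \<le> K" for x
    proof -
      have "\<bar>real (Suc n) * x\<bar> \<le> real (Suc n) * K"
        using that by (simp add: abs_mult)
      then have "\<lfloor>real (Suc n) * x\<rfloor> \<in> {- N..N}"
        unfolding N_def atLeastAtMost_iff by linarith
      then show ?thesis
        by (auto simp: S_def r_def)
    qed
    moreover have "\<bar>Re (f t)\<bar> \<le> K" "\<bar>Im (f t)\<bar> \<le> K" for t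
      using K(1)[of t] abs_Re_le_cmod[of "f t"] abs_Im_le_cmod[of "f t"] by linarith+
    ultimately have "range (F n) \<subseteq> (\<lambda>(x, y). Complex x y) ` (S \<times> S)"
      by (auto simp: F_def)
    then show ?thesis
      by (rule finite_subset) (simp add: S_def)
  qed
  have simple: "bounded_borel (\<lambda>t. \<Sum>y\<in>Y. y * indicator (F n -` {y}) t) \<and>
      P (\<lambda>t. \<Sum>y\<in>Y. y * indicator (F n -` {y}) t)" if "finite Y" for n Y
    using that
  proof induction
    case empty
    \<comment> \<open>The zero function is obtained as 0 times the indicator of the empty
      set.\<close>
    show ?case
      using scale[OF bounded_borel_indicator ind, of "{}" 0] by (simp add: bounded_borel_const)
  next
    case (insert y Y)
    have B: "F n -` {y} \<in> sets borel"
      using measurable_sets[OF F_meas, of "{y}" n] by simp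
    note y = bounded_borel_scale[OF bounded_borel_indicator, OF B, of y]
      scale[OF bounded_borel_indicator ind, OF B B, of y]
    show ?case
      unfolding sum.insert[OF insert.hyps]
      using insert.IH by (intro conjI add[OF y(1) _ y(2)] bounded_borel_add[OF y(1)]) auto
  qed
  have F_sum: "(\<lambda>t. \<Sum>y\<in>range (F n). y * indicator (F n -` {y}) t) = F n" for n
  proof
    fix t
    have "(\<Sum>y\<in>range (F n). y * indicator (F n -` {y}) t) = (\<Sum>y\<in>range (F n). if y = F n t then y else 0)"
      by (rule sum.cong) (auto simp: indicator_def)
    then show "(\<Sum>y\<in>range (F n). y * indicator (F n -` {y}) t) = F n t"
      using finite_range[of n] by (simp add: sum.delta)
  qed
  have F: "bounded_borel (F n)" "P (F n)" for n
    using simple[OF finite_range[of n], of n] unfolding F_sum by auto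
  have "uniform_limit UNIV F f sequentially"
  proof (rule uniform_limitI)
    fix e :: real
    assume "e > 0"
    then have "\<forall>\<^sub>F n in sequentially. 2 / real (Suc n) < e"
      using order_tendstoD(2)[OF LIMSEQ_Suc[OF lim_const_over_n[of "2 :: real"]]] by simp
    then show "\<forall>\<^sub>F n in sequentially. \<forall>t\<in>UNIV. dist (F n t) (f t) < e"
    proof (rule eventually_mono, intro ballI)
      fix n t
      assume n: "2 / real (Suc n) < e"
      have "dist (F n t) (f t) \<le> \<bar>Re (F n t - f t)\<bar> + \<bar>Im (F n t - f t)\<bar>"
        unfolding dist_norm by (rule cmod_le)
      also have "\<dots> \<le> 1 / real (Suc n) + 1 / real (Suc n)"
        using r by (intro add_mono) (auto simp: F_def)
      finally show "dist (F n t) (f t) < e"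
        using n by simp
    qed
  qed
  from lim[OF F f this] show ?thesis .
qed

section \<open>Sums of measures\<close>

text \<open>Having sums on both sides avoids subtracting possibly infinite integrals. The
  parallelogram law uses all four measures; a null measure gives the case of one measure against
  two.\<close>

lemma nn_integral_add_eq_add:
  assumes f: "f \<in> borel_measurable M"
    and sets: "sets A = sets M" "sets B = sets M" "sets C = sets M" "sets D = sets M"
    and eq: "\<And>X. X \<in> sets M \<Longrightarrow> emeasure A X + emeasure B X = emeasure C X + emeasure D X"
  shows "(\<integral>\<^sup>+x. f x \<partial>A) + (\<integral>\<^sup>+x. f x \<partial>B) = (\<integral>\<^sup>+x. f x \<partial>C) + (\<integral>\<^sup>+x. f x \<partial>D)"
  using f
proof (induction rule: borel_measurable_induct)
  case (cong f g)
  have "space A = space M" "space B = space M" "space C = space M" "space D = space M"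
    using sets by (auto dest: sets_eq_imp_space_eq)
  then show ?case
    using cong by (simp cong: nn_integral_cong_simp)
next
  case (set X)
  then show ?case
    using eq by (simp add: sets)
next
  case (mult u c)
  then have [measurable]: "u \<in> borel_measurable A" "u \<in> borel_measurable B"
      "u \<in> borel_measurable C" "u \<in> borel_measurable D"
    using sets by (auto cong: measurable_cong_sets)
  show ?case
    using mult by (simp add: nn_integral_cmult flip: distrib_left)
next
  case (add u v)
  then have [measurable]: "u \<in> borel_measurable A" "u \<in> borel_measurable B"
      "u \<in> borel_measurable C" "u \<in> borel_measurable D"
      "v \<in> borel_measurable A" "v \<in> borel_measurable B"
      "v \<in> borel_measurable C" "v \<in> borel_measurable D"
    using sets by (auto cong: measurable_cong_sets)
  have "((\<integral>\<^sup>+x. u x \<partial>A) + (\<integral>\<^sup>+x. u x \<partial>B)) + ((\<integral>\<^sup>+x. v x \<partial>A) + (\<integral>\<^sup>+x. v x \<partial>B))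
      = ((\<integral>\<^sup>+x. u x \<partial>C) + (\<integral>\<^sup>+x. u x \<partial>D)) + ((\<integral>\<^sup>+x. v x \<partial>C) + (\<integral>\<^sup>+x. v x \<partial>D))"
    by (simp only: add)
  then show ?case
    by (simp add: nn_integral_add ac_simps)
next
  case (seq U)
  have meas: "U i \<in> borel_measurable N" if "sets N = sets M" for i N
    using seq(1)[of i] that by (simp cong: measurable_cong_sets)
  have SUP: "(\<integral>\<^sup>+x. (SUP i. U i) x \<partial>N) = (SUP i. \<integral>\<^sup>+x. U i x \<partial>N)" if "sets N = sets M" for N
    using nn_integral_monotone_convergence_SUP[OF \<open>incseq U\<close> meas[OF that]] by (simp add: image_comp)
  have inc: "incseq (\<lambda>i. \<integral>\<^sup>+x. U i x \<partial>N)" for N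
    using \<open>incseq U\<close> by (auto simp: incseq_def le_fun_def intro!: nn_integral_mono)
  show ?case
    by (simp only: SUP sets ennreal_SUP_add[OF inc inc, symmetric] seq)
qed

lemma nn_integral_add_measure:
  assumes f: "f \<in> borel_measurable M"
    and sets: "sets A = sets M" "sets B = sets M" "sets C = sets M"
    and eq: "\<And>X. X \<in> sets M \<Longrightarrow> emeasure C X = emeasure A X + emeasure B X"
  shows "(\<integral>\<^sup>+x. f x \<partial>C) = (\<integral>\<^sup>+x. f x \<partial>A) + (\<integral>\<^sup>+x. f x \<partial>B)"
  using nn_integral_add_eq_add[OF f, of C "null_measure M" A B] assms by simp

lemma integrable_add_measure:
  fixes f :: "'x \<Rightarrow> 'b::{banach, second_countable_topology}"
  assumes f: "f \<in> borel_measurable M"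
    and sets: "sets A = sets M" "sets B = sets M" "sets C = sets M"
    and eq: "\<And>X. X \<in> sets M \<Longrightarrow> emeasure C X = emeasure A X + emeasure B X"
  shows "integrable C f \<longleftrightarrow> integrable A f \<and> integrable B f"
proof -
  have [simp]: "f \<in> borel_measurable N" if "sets N = sets M" for N
    using f that by (simp cong: measurable_cong_sets)
  have "(\<integral>\<^sup>+x. ennreal (norm (f x)) \<partial>C)
      = (\<integral>\<^sup>+x. ennreal (norm (f x)) \<partial>A) + (\<integral>\<^sup>+x. ennreal (norm (f x)) \<partial>B)"
    by (rule nn_integral_add_measure[OF _ sets eq]) (use f in measurable)
  then show ?thesis
    by (simp add: integrable_iff_bounded sets)
qed

text \<open>Positive and negative parts add separately as extended reals; integrability for A and B
  makes them finite, so \<open>enn2real\<close> respects the sums.\<close>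

lemma real_integral_add_measure:
  fixes f :: "'x \<Rightarrow> real"
  assumes f: "f \<in> borel_measurable M"
    and sets: "sets A = sets M" "sets B = sets M" "sets C = sets M"
    and eq: "\<And>X. X \<in> sets M \<Longrightarrow> emeasure C X = emeasure A X + emeasure B X"
    and int: "integrable A f" "integrable B f"
  shows "integral\<^sup>L C f = integral\<^sup>L A f + integral\<^sup>L B f"
proof -
  have C: "integrable C f"
    using int integrable_add_measure[OF f sets eq] by simp
  have fin: "(\<integral>\<^sup>+x. ennreal (f x) \<partial>N) < \<infinity>" "(\<integral>\<^sup>+x. ennreal (- f x) \<partial>N) < \<infinity>"
    if "integrable N f" for N
    using that unfolding real_integrable_def by (auto simp: top.not_eq_extremum)
  have "(\<integral>\<^sup>+x. ennreal (f x) \<partial>C) = (\<integral>\<^sup>+x. ennreal (f x) \<partial>A) + (\<integral>\<^sup>+x. ennreal (f x) \<partial>B)"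
    "(\<integral>\<^sup>+x. ennreal (- f x) \<partial>C) = (\<integral>\<^sup>+x. ennreal (- f x) \<partial>A) + (\<integral>\<^sup>+x. ennreal (- f x) \<partial>B)"
    using f by (intro nn_integral_add_measure[OF _ sets eq]; simp)+
  then show ?thesis
    using fin[OF int(1)] fin[OF int(2)]
    by (simp add: real_lebesgue_integral_def C int enn2real_plus)
qed

lemma complex_integral_add_measure:
  fixes f :: "'x \<Rightarrow> complex"
  assumes f: "f \<in> borel_measurable M"
    and sets: "sets A = sets M" "sets B = sets M" "sets C = sets M"
    and eq: "\<And>X. X \<in> sets M \<Longrightarrow> emeasure C X = emeasure A X + emeasure B X"
    and int: "integrable A f" "integrable B f"
  shows "integral\<^sup>L C f = integral\<^sup>L A f + integral\<^sup>L B f"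
proof (rule complex_eqI)
  have C: "integrable C f"
    using int integrable_add_measure[OF f sets eq] by simp
  have "(\<integral>x. Re (f x) \<partial>C) = (\<integral>x. Re (f x) \<partial>A) + (\<integral>x. Re (f x) \<partial>B)"
    "(\<integral>x. Im (f x) \<partial>C) = (\<integral>x. Im (f x) \<partial>A) + (\<integral>x. Im (f x) \<partial>B)"
    using f int by (intro real_integral_add_measure[OF _ sets eq]; simp)+
  then show "Re (integral\<^sup>L C f) = Re (integral\<^sup>L A f + integral\<^sup>L B f)"
    "Im (integral\<^sup>L C f) = Im (integral\<^sup>L A f + integral\<^sup>L B f)"
    using C int by simp_all
qed

section \<open>Bounded functional calculus of a projection-valued measure\<close>

lemma sets_spectral_dist [simp, measurable_cong]: "sets (spectral_dist E \<psi>) = sets borel"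
  using sets.sigma_sets_eq[of "borel :: real measure"] by (simp add: spectral_dist_def)

lemma space_spectral_dist [simp]: "space (spectral_dist E \<psi>) = UNIV"
  by (simp add: spectral_dist_def)

locale pvm =
  fixes E :: "real set \<Rightarrow> 'a::complex_inner \<Rightarrow> 'a"
  assumes pvm: "projection_valued_measure E"
begin

lemma proj: "B \<in> sets borel \<Longrightarrow> orth_projection (E B)"
  and E_empty: "E {} = (\<lambda>\<psi>. 0)"
  and E_UNIV: "E UNIV = id"
  and E_Int: "B \<in> sets borel \<Longrightarrow> C \<in> sets borel \<Longrightarrow> E (B \<inter> C) = E B \<circ> E C"
  and E_sums: "range A \<subseteq> sets borel \<Longrightarrow> disjoint_family A \<Longrightarrow> (\<lambda>n. E (A n) \<psi>) sums E (\<Union>n. A n) \<psi>"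
  for A :: "nat \<Rightarrow> real set"
  using pvm by (auto simp: projection_valued_measure_def)

lemma clinear_E: "B \<in> sets borel \<Longrightarrow> clinear_map (E B)"
  and E_adjoint: "B \<in> sets borel \<Longrightarrow> cinner \<phi> (E B \<psi>) = cinner (E B \<phi>) \<psi>"
  using proj by (auto simp: orth_projection_def)

lemmas E_add = clinear_map_add[OF clinear_E]
  and E_scaleC = clinear_map_scaleC[OF clinear_E]

lemma E_minus: "B \<in> sets borel \<Longrightarrow> E B (- \<psi>) = - E B \<psi>"
  using E_scaleC[of B "-1" \<psi>] by (simp add: scaleC_minus_one)

text \<open>Since \<open>E B\<close> is a self-adjoint idempotent, the set function is a squared
  norm and hence nonnegative. Its countable additivity is the vector-valued one under the continuous
  functional \<open>inner \<psi>\<close>.\<close>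

lemma emeasure_spectral_dist:
  assumes "B \<in> sets borel"
  shows "emeasure (spectral_dist E \<psi>) B = ennreal ((norm (E B \<psi>))\<^sup>2)"
proof -
  let ?\<mu> = "\<lambda>B. ennreal (Re (cinner \<psi> (E B \<psi>)))"
  have "countably_additive (sets borel) ?\<mu>"
  proof (rule countably_additiveI)
    fix A :: "nat \<Rightarrow> real set"
    assume A: "range A \<subseteq> sets borel" "disjoint_family A"
    have "(\<lambda>n. Re (cinner \<psi> (E (A n) \<psi>))) sums Re (cinner \<psi> (E (\<Union>n. A n) \<psi>))"
      using bounded_linear.sums[OF bounded_linear_inner_right E_sums[OF A], of \<psi> \<psi>]
      by (simp add: inner_Re_cinner)
    moreover have "0 \<le> Re (cinner \<psi> (E (A n) \<psi>))" for n
      using A(1) by (simp add: orth_projection_norm[OF proj] range_subsetD)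
    ultimately show "(\<Sum>n. ?\<mu> (A n)) = ?\<mu> (\<Union>n. A n)"
      by (intro suminf_ennreal_eq)
  qed
  moreover have "positive (sets borel) ?\<mu>"
    by (simp add: positive_def E_empty)
  moreover have "sigma_algebra UNIV (sets (borel :: real measure))"
    using sets.sigma_algebra_axioms[of "borel :: real measure"] by simp
  ultimately have "emeasure (spectral_dist E \<psi>) B = ?\<mu> B"
    unfolding spectral_dist_def using assms by (intro emeasure_measure_of_sigma) auto
  then show ?thesis
    by (simp add: orth_projection_norm[OF proj[OF assms]])
qed

lemma measure_spectral_dist:
  "B \<in> sets borel \<Longrightarrow> measure (spectral_dist E \<psi>) B = (norm (E B \<psi>))\<^sup>2"
  by (simp add: measure_def emeasure_spectral_dist)

sublocale finite_measure "spectral_dist E \<psi>" for \<psi>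
  by (rule finite_measureI) (simp add: emeasure_spectral_dist)

lemma integrable_bounded_borel:
  assumes "bounded_borel f"
  shows "integrable (spectral_dist E \<psi>) f"
proof -
  obtain K where "cmod (f t) \<le> K" for t
    using assms by (meson bounded_borelE)
  then show ?thesis
    using bounded_borel_measurable[OF assms]
    by (intro integrable_const_bound[where B = K]) (auto cong: measurable_cong_sets)
qed

text \<open>The parallelogram law for the norms of \<open>E X \<phi>\<close> and
  \<open>E X \<psi>\<close> carries over to the integrals of \<open>norm \<circ> f\<close>, bounded
  or not. Polarization needs this at the vectors
  \<open>\<psi> + \<i> ^ k *\<^sub>C \<eta>\<close>.\<close>

lemma integrable_spectral_dist_add:
  fixes f :: "real \<Rightarrow> 'b::{banach, second_countable_topology}"
  assumes "integrable (spectral_dist E \<phi>) f" "integrable (spectral_dist E \<psi>) f"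
  shows "integrable (spectral_dist E (\<phi> + \<psi>)) f"
proof -
  have f: "f \<in> borel_measurable borel"
    using borel_measurable_integrable[OF assms(1)] by (simp cong: measurable_cong_sets)
  let ?I = "\<lambda>\<psi>. \<integral>\<^sup>+x. ennreal (norm (f x)) \<partial>spectral_dist E \<psi>"
  have "?I (\<phi> + \<psi>) + ?I (\<phi> - \<psi>)
      = (\<integral>\<^sup>+x. ennreal (norm (f x)) \<partial>scale_measure 2 (spectral_dist E \<phi>))
      + (\<integral>\<^sup>+x. ennreal (norm (f x)) \<partial>scale_measure 2 (spectral_dist E \<psi>))"
  proof (rule nn_integral_add_eq_add[where M = borel])
    fix X :: "real set"
    assume X: "X \<in> sets borel"
    have "(norm (E X \<phi> + E X \<psi>))\<^sup>2 + (norm (E X \<phi> - E X \<psi>))\<^sup>2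
        = 2 * (norm (E X \<phi>))\<^sup>2 + 2 * (norm (E X \<psi>))\<^sup>2"
      by (simp add: power2_norm_eq_inner inner_add_left inner_add_right inner_diff_left
          inner_diff_right inner_commute)
    then show "emeasure (spectral_dist E (\<phi> + \<psi>)) X + emeasure (spectral_dist E (\<phi> - \<psi>)) X
        = emeasure (scale_measure 2 (spectral_dist E \<phi>)) X
        + emeasure (scale_measure 2 (spectral_dist E \<psi>)) X"
      using X E_add[OF X, of \<phi> "- \<psi>"]
      by (simp add: emeasure_spectral_dist E_add E_minus flip: ennreal_plus ennreal_numeral ennreal_mult)
  qed (use f in auto)
  also have "\<dots> = 2 * ?I \<phi> + 2 * ?I \<psi>"
    using f by (simp add: nn_integral_scale_measure cong: measurable_cong_sets)
  also have "\<dots> < \<infinity>"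
    using assms by (simp add: integrable_iff_bounded ennreal_mult_less_top)
  finally show ?thesis
    using f by (simp add: integrable_iff_bounded cong: measurable_cong_sets)
qed

lemma spectral_dist_scaleC: "spectral_dist E (a *\<^sub>C \<psi>) = scale_measure (ennreal ((cmod a)\<^sup>2)) (spectral_dist E \<psi>)"
  by (rule measure_eqI)
    (simp_all add: emeasure_spectral_dist E_scaleC norm_scaleC power_mult_distrib ennreal_mult)

lemma integrable_spectral_dist_scaleC:
  fixes f :: "real \<Rightarrow> 'b::{banach, second_countable_topology}"
  assumes "integrable (spectral_dist E \<psi>) f"
  shows "integrable (spectral_dist E (a *\<^sub>C \<psi>)) f"
proof -
  have [measurable]: "f \<in> borel_measurable (spectral_dist E \<psi>)"
    using assms by (rule borel_measurable_integrable)
  have "(\<integral>\<^sup>+x. ennreal (norm (f x)) \<partial>spectral_dist E (a *\<^sub>C \<psi>))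
      = ennreal ((cmod a)\<^sup>2) * (\<integral>\<^sup>+x. ennreal (norm (f x)) \<partial>spectral_dist E \<psi>)"
    unfolding spectral_dist_scaleC by (rule nn_integral_scale_measure) measurable
  then show ?thesis
    using assms by (simp add: integrable_iff_bounded ennreal_mult_less_top cong: measurable_cong_sets)
qed

lemma spectral_form_add:
  assumes "bounded_borel f" "bounded_borel g"
  shows "spectral_form E (\<lambda>t. f t + g t) \<eta> \<psi> = spectral_form E f \<eta> \<psi> + spectral_form E g \<eta> \<psi>"
  using assms
  by (simp add: spectral_form_def integrable_bounded_borel sum.distrib distrib_left add_divide_distrib)

lemma spectral_form_scale:
  "spectral_form E (\<lambda>t. a * f t) \<eta> \<psi> = a * spectral_form E f \<eta> \<psi>"
  by (simp add: spectral_form_def sum_distrib_left mult.left_commute)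

lemma spectral_form_indicator:
  assumes "B \<in> sets borel"
  shows "spectral_form E (indicator B) \<eta> \<psi> = cinner \<eta> (E B \<psi>)"
proof -
  have "(\<integral>t. indicator B t \<partial>spectral_dist E \<phi>) = complex_of_real ((norm (E B \<phi>))\<^sup>2)" for \<phi>
  proof -
    have "(\<integral>t. indicator B t \<partial>spectral_dist E \<phi>)
        = complex_of_real (\<integral>t. indicator B t \<partial>spectral_dist E \<phi>)"
      unfolding integral_complex_of_real[symmetric]
      by (rule Bochner_Integration.integral_cong) (auto simp: indicator_def)
    then show ?thesis
      using assms by (simp add: measure_spectral_dist)
  qed
  then show ?thesis
    unfolding spectral_form_def using orth_projection_polarization[OF proj[OF assms]] by simp
qed

text \<open>Each measure has total mass
  \<open>(norm (\<psi> + \<i> ^ k *\<^sub>C \<eta>))\<^sup>2\<close>; these masses add up to four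
  times the bracket, and the denominator of the form cancels the 4.\<close>

lemma spectral_form_bound:
  assumes "bounded_borel f" "\<And>t. cmod (f t) \<le> \<epsilon>"
  shows "cmod (spectral_form E f \<eta> \<psi>) \<le> \<epsilon> * ((norm \<eta>)\<^sup>2 + (norm \<psi>)\<^sup>2)"
proof -
  have *: "cmod (\<integral>t. f t \<partial>spectral_dist E \<phi>) \<le> \<epsilon> * (norm \<phi>)\<^sup>2" for \<phi>
  proof -
    have "cmod (\<integral>t. f t \<partial>spectral_dist E \<phi>) \<le> (\<integral>t. cmod (f t) \<partial>spectral_dist E \<phi>)"
      by (rule integral_norm_bound)
    also have "\<dots> \<le> (\<integral>t. \<epsilon> \<partial>spectral_dist E \<phi>)"
      using assms integrable_bounded_borel by (intro integral_mono) auto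
    also have "\<dots> = \<epsilon> * (norm \<phi>)\<^sup>2"
      by (simp add: measure_spectral_dist E_UNIV)
    finally show ?thesis .
  qed
  have "cmod (\<Sum>k<4. \<i> ^ k * (\<integral>t. f t \<partial>spectral_dist E (\<psi> + \<i> ^ k *\<^sub>C \<eta>)))
      \<le> (\<Sum>k<4. \<epsilon> * (norm (\<psi> + \<i> ^ k *\<^sub>C \<eta>))\<^sup>2)"
    using * by (intro sum_norm_le) (simp add: norm_mult norm_power)
  also have "\<dots> = 4 * (\<epsilon> * ((norm \<eta>)\<^sup>2 + (norm \<psi>)\<^sup>2))"
    unfolding sum_distrib_left[symmetric] sum_norm_polarization by simp
  finally show ?thesis
    by (simp add: spectral_form_def norm_divide)
qed

lemma spectral_form_diff:
  assumes "bounded_borel f" "bounded_borel g"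
  shows "spectral_form E (\<lambda>t. f t - g t) \<eta> \<psi> = spectral_form E f \<eta> \<psi> - spectral_form E g \<eta> \<psi>"
  using spectral_form_add[OF assms(1) bounded_borel_scale[OF assms(2)], of "-1"]
    spectral_form_scale[of "-1" g] by simp

lemma spectral_form_diff_le:
  assumes "bounded_borel f" "bounded_borel g" "\<And>t. cmod (f t - g t) \<le> \<epsilon>"
  shows "cmod (spectral_form E f \<eta> \<psi> - spectral_form E g \<eta> \<psi>) \<le> \<epsilon> * ((norm \<eta>)\<^sup>2 + (norm \<psi>)\<^sup>2)"
proof -
  have "bounded_borel (\<lambda>t. f t - g t)"
    using bounded_borel_add[OF assms(1) bounded_borel_scale[OF assms(2), of "-1"]] by simp
  then show ?thesis
    using spectral_form_bound[of "\<lambda>t. f t - g t"] assms by (simp add: spectral_form_diff)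
qed

lemma tendsto_spectral_form:
  assumes F: "\<And>n. bounded_borel (F n)" and f: "bounded_borel f"
    and lim: "uniform_limit UNIV F f sequentially"
  shows "(\<lambda>n. spectral_form E (F n) \<eta> \<psi>) \<longlonglongrightarrow> spectral_form E f \<eta> \<psi>"
proof (rule LIMSEQ_I)
  fix e :: real
  assume e: "e > 0"
  \<comment> \<open>The \<open>+ 1\<close> keeps c positive when both vectors vanish and makes the
    final estimate strict.\<close>
  define c where "c = (norm \<eta>)\<^sup>2 + (norm \<psi>)\<^sup>2 + 1"
  have c: "c > 0"
    by (simp add: c_def add_nonneg_pos)
  then obtain N where N: "\<And>n t. n \<ge> N \<Longrightarrow> dist (F n t) (f t) < e / c"
    using uniform_limitD[OF lim, of "e / c"] e by (auto simp: eventually_sequentially)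
  show "\<exists>N. \<forall>n\<ge>N. norm (spectral_form E (F n) \<eta> \<psi> - spectral_form E f \<eta> \<psi>) < e"
  proof (intro exI allI impI)
    fix n
    assume n: "n \<ge> N"
    have "norm (spectral_form E (F n) \<eta> \<psi> - spectral_form E f \<eta> \<psi>) \<le> e / c * (c - 1)"
      using spectral_form_diff_le[OF F f, of n "e / c" \<eta> \<psi>] N[OF n]
      by (auto simp: c_def dist_norm less_imp_le)
    also have "\<dots> < e"
      using c e by (simp add: field_simps)
    finally show "norm (spectral_form E (F n) \<eta> \<psi> - spectral_form E f \<eta> \<psi>) < e" .
  qed
qed

text \<open>Hidden by the polarized definition, whose measures are quadratic in the vector. It is
  inherited from \<open>cinner \<eta> (E B \<psi>)\<close>, the value on indicators.\<close>

lemma spectral_form_add_right: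
  assumes "bounded_borel f"
  shows "spectral_form E f \<eta> (\<phi> + \<psi>) = spectral_form E f \<eta> \<phi> + spectral_form E f \<eta> \<psi>"
  using assms
proof (induction rule: bounded_borel_induct)
  case (lim F f)
  show ?case
    by (rule LIMSEQ_unique[OF tendsto_spectral_form[OF lim(1,2,3)]])
      (use tendsto_add[OF tendsto_spectral_form[OF lim(1,2,3)] tendsto_spectral_form[OF lim(1,2,3)]]
        in \<open>simp add: lim(4)\<close>)
qed (simp_all add: spectral_form_indicator E_add cinner_add_right spectral_form_add
      spectral_form_scale algebra_simps)

lemma spectral_form_scaleC_right:
  assumes "bounded_borel f"
  shows "spectral_form E f \<eta> (a *\<^sub>C \<psi>) = a * spectral_form E f \<eta> \<psi>"
  using assms
proof (induction rule: bounded_borel_induct)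
  case (lim F f)
  show ?case
    by (rule LIMSEQ_unique[OF tendsto_spectral_form[OF lim(1,2,3)]])
      (use tendsto_mult_left[OF tendsto_spectral_form[OF lim(1,2,3)]] in \<open>simp add: lim(4)\<close>)
qed (simp_all add: spectral_form_indicator E_scaleC cinner_scaleC_right spectral_form_add
      spectral_form_scale algebra_simps)

lemma spectral_form_cnj:
  assumes "bounded_borel f"
  shows "spectral_form E (\<lambda>t. cnj (f t)) \<eta> \<psi> = cnj (spectral_form E f \<psi> \<eta>)"
  using assms
proof (induction rule: bounded_borel_induct)
  case (indicator B)
  have "(\<lambda>t. cnj (indicator B t)) = (indicator B :: real \<Rightarrow> complex)"
    by (auto simp: indicator_def)
  then show ?case
    using indicator E_adjoint[of B \<eta> \<psi>] cinner_commute[of "E B \<eta>" \<psi>]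
    by (simp add: spectral_form_indicator)
next
  case (lim F f)
  have "uniform_limit UNIV (\<lambda>n t. cnj (F n t)) (\<lambda>t. cnj (f t)) sequentially"
    using lim(3) by (simp add: uniform_limit_iff dist_norm flip: complex_cnj_diff)
  then have "(\<lambda>n. spectral_form E (\<lambda>t. cnj (F n t)) \<eta> \<psi>) \<longlonglongrightarrow> spectral_form E (\<lambda>t. cnj (f t)) \<eta> \<psi>"
    by (intro tendsto_spectral_form bounded_borel_cnj lim)
  then show ?case
    using LIMSEQ_unique tendsto_cnj[OF tendsto_spectral_form[OF lim(1,2,3)], of \<psi> \<eta>]
    by (simp add: lim(4))
qed (simp_all add: spectral_form_add spectral_form_scale bounded_borel_cnj)

text \<open>On indicators this is \<open>E (B \<inter> C) = E B \<circ> E C\<close>. It supplies the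
  indicator case of \<open>borel_op_mult\<close>.\<close>

lemma spectral_form_E_left:
  assumes B: "B \<in> sets borel" and "bounded_borel f"
  shows "spectral_form E f (E B \<eta>) \<psi> = spectral_form E (\<lambda>t. indicator B t * f t) \<eta> \<psi>"
  using assms(2)
proof (induction rule: bounded_borel_induct)
  case (indicator C)
  have "(\<lambda>t. indicator B t * indicator C t) = (indicator (B \<inter> C) :: real \<Rightarrow> complex)"
    by (auto simp: indicator_def)
  then show ?case
    using indicator B by (simp add: spectral_form_indicator E_Int flip: E_adjoint)
next
  case (add f g)
  then show ?case
    using B by (simp add: spectral_form_add distrib_left bounded_borel_mult bounded_borel_indicator)
next
  case (scale a f)
  then show ?case
    by (simp add: spectral_form_scale mult.left_commute)
next
  case (lim F f)
  have "uniform_limit UNIV (\<lambda>n t. indicator B t * F n t) (\<lambda>t. indicator B t * f t) sequentially"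
  proof (rule uniform_limitI)
    fix e :: real
    assume "e > 0"
    with lim(3) have "\<forall>\<^sub>F n in sequentially. \<forall>t\<in>UNIV. dist (F n t) (f t) < e"
      by (rule uniform_limitD)
    then show "\<forall>\<^sub>F n in sequentially. \<forall>t\<in>UNIV. dist (indicator B t * F n t) (indicator B t * f t) < e"
      by (rule eventually_mono) (use \<open>e > 0\<close> in \<open>auto simp: indicator_def\<close>)
  qed
  then have "(\<lambda>n. spectral_form E (\<lambda>t. indicator B t * F n t) \<eta> \<psi>)
      \<longlonglongrightarrow> spectral_form E (\<lambda>t. indicator B t * f t) \<eta> \<psi>"
    by (intro tendsto_spectral_form bounded_borel_mult bounded_borel_indicator B lim)
  then show ?case
    using LIMSEQ_unique[OF tendsto_spectral_form[OF lim(1,2,3)]] by (simp add: lim(4))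
qed

end

section \<open>Operators of bounded Borel functions on a complete space\<close>

locale complete_pvm = pvm E
  for E :: "real set \<Rightarrow> 'a::{complex_inner, complete_space} \<Rightarrow> 'a"
begin

text \<open>
  If \<open>\<bar>f - g\<bar> \<le> \<epsilon>\<close> and \<open>\<delta>\<close> is the difference of the representing vectors, the crude bound on the form
  gives \<open>\<parallel>\<delta>\<parallel>\<^sup>2 \<le> \<epsilon> (\<parallel>\<delta>\<parallel>\<^sup>2 + \<parallel>\<psi>\<parallel>\<^sup>2)\<close>; this is enough for completeness to replace the Riesz
  representation theorem.
\<close>

lemma ex_represents_spectral_form:
  assumes "bounded_borel f"
  shows "\<exists>\<phi>. \<forall>\<eta>. cinner \<eta> \<phi> = spectral_form E f \<eta> \<psi>"
  using assms
proof (induction rule: bounded_borel_induct)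
  case (indicator B)
  then show ?case
    by (auto simp: spectral_form_indicator)
next
  case (add f g)
  then show ?case
    by (metis cinner_add_right spectral_form_add)
next
  case (scale a f)
  then show ?case
    by (metis cinner_scaleC_right spectral_form_scale)
next
  case (lim F f)
  then obtain \<Phi> where \<Phi>: "\<And>n \<eta>. cinner \<eta> (\<Phi> n) = spectral_form E (F n) \<eta> \<psi>"
    by metis
  have "Cauchy \<Phi>"
  proof (rule CauchyI)
    fix e :: real
    assume e: "e > 0"
    \<comment> \<open>The bound \<open>1 / 2\<close> allows the term with
      \<open>norm ?\<delta>\<close> to be absorbed on the left, and the second bound leaves at most
      \<open>e\<^sup>2 / 2\<close>. The \<open>+ 1\<close> covers \<open>\<psi> = 0\<close>.\<close>
    define \<epsilon> where "\<epsilon> = min (1 / 2) (e\<^sup>2 / (4 * ((norm \<psi>)\<^sup>2 + 1)))"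
    have \<epsilon>_le: "\<epsilon> \<le> 1 / 2" "\<epsilon> \<le> e\<^sup>2 / (4 * ((norm \<psi>)\<^sup>2 + 1))"
      unfolding \<epsilon>_def by (rule min.cobounded1, rule min.cobounded2)
    have pos: "(norm \<psi>)\<^sup>2 + 1 > 0"
      by (simp add: add_nonneg_pos)
    then have "\<epsilon> > 0"
      using e by (simp add: \<epsilon>_def)
    then obtain N where N: "\<And>n t. n \<ge> N \<Longrightarrow> dist (F n t) (f t) < \<epsilon> / 2"
      using uniform_limitD[OF lim(3), of "\<epsilon> / 2"] by (auto simp: eventually_sequentially)
    show "\<exists>M. \<forall>m\<ge>M. \<forall>n\<ge>M. norm (\<Phi> m - \<Phi> n) < e"
    proof (intro exI allI impI)
      fix m n
      assume mn: "m \<ge> N" "n \<ge> N"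
      let ?\<delta> = "\<Phi> m - \<Phi> n"
      have "cmod (F m t - F n t) \<le> \<epsilon>" for t
        using dist_triangle_half_l[OF N[OF mn(1)] N[OF mn(2)], of t] by (simp add: dist_norm)
      then have "cmod (spectral_form E (F m) ?\<delta> \<psi> - spectral_form E (F n) ?\<delta> \<psi>)
          \<le> \<epsilon> * ((norm ?\<delta>)\<^sup>2 + (norm \<psi>)\<^sup>2)"
        by (intro spectral_form_diff_le lim)
      then have "(norm ?\<delta>)\<^sup>2 \<le> \<epsilon> * ((norm ?\<delta>)\<^sup>2 + (norm \<psi>)\<^sup>2)"
        unfolding \<Phi>[symmetric] cinner_diff_right[symmetric] cinner_self by (simp add: norm_power)
      moreover have "\<epsilon> * (norm ?\<delta>)\<^sup>2 \<le> 1 / 2 * (norm ?\<delta>)\<^sup>2"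
        by (intro mult_right_mono \<epsilon>_le) simp
      ultimately have "(norm ?\<delta>)\<^sup>2 \<le> 2 * (\<epsilon> * (norm \<psi>)\<^sup>2)"
        by (simp add: distrib_left)
      also have "\<epsilon> * (norm \<psi>)\<^sup>2 \<le> e\<^sup>2 / (4 * ((norm \<psi>)\<^sup>2 + 1)) * ((norm \<psi>)\<^sup>2 + 1)"
        using \<open>\<epsilon> > 0\<close> pos e by (intro mult_mono \<epsilon>_le) simp_all
      also have "\<dots> = e\<^sup>2 / 4"
        using less_imp_neq[OF pos] by (simp add: divide_simps)
      finally have "(norm ?\<delta>)\<^sup>2 < e\<^sup>2"
        using zero_less_power[OF e, of 2] by linarith
      then show "norm ?\<delta> < e"
        using e by (simp add: power2_less_imp_less)
    qed
  qed
  then obtain \<phi> where \<phi>: "\<Phi> \<longlonglongrightarrow> \<phi>"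
    using Cauchy_convergent convergent_def by blast
  have "cinner \<eta> \<phi> = spectral_form E f \<eta> \<psi>" for \<eta>
    using LIMSEQ_unique[OF tendsto_cinner_right[OF \<phi>]] tendsto_spectral_form[OF lim(1,2,3)]
    by (simp add: \<Phi>)
  then show ?case
    by blast
qed

definition borel_op :: "(real \<Rightarrow> complex) \<Rightarrow> 'a \<Rightarrow> 'a" where
  "borel_op f \<psi> = (SOME \<phi>. \<forall>\<eta>. cinner \<eta> \<phi> = spectral_form E f \<eta> \<psi>)"

lemma cinner_borel_op:
  "bounded_borel f \<Longrightarrow> cinner \<eta> (borel_op f \<psi>) = spectral_form E f \<eta> \<psi>"
  using someI_ex[OF ex_represents_spectral_form[of f \<psi>]] by (simp add: borel_op_def)

text \<open>A bounded function has the whole space as its domain, so the weak equation is tested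
  against every vector and determines a unique value.\<close>

lemma spectral_integral_eq_op_graph:
  assumes "bounded_borel f"
  shows "spectral_integral E f = op_graph (borel_op f)"
proof -
  have "spectral_domain E f = UNIV"
    using integrable_norm[OF integrable_bounded_borel[OF bounded_borel_mult[OF assms assms]]]
    by (auto simp: spectral_domain_def norm_mult power2_eq_square)
  moreover have "(\<forall>\<eta>. cinner \<eta> \<phi> = spectral_form E f \<eta> \<psi>) \<longleftrightarrow> \<phi> = borel_op f \<psi>" for \<phi> \<psi>
    by (metis assms cinner_borel_op cinner_eqI)
  ultimately show ?thesis
    by (auto simp: spectral_integral_def op_graph_def)
qed

lemma borel_op_add:
  assumes "bounded_borel f" "bounded_borel g"
  shows "borel_op (\<lambda>t. f t + g t) \<psi> = borel_op f \<psi> + borel_op g \<psi>"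
  using assms by (intro cinner_eqI)
    (simp add: cinner_borel_op bounded_borel_add cinner_add_right spectral_form_add)

lemma borel_op_scale:
  assumes "bounded_borel f"
  shows "borel_op (\<lambda>t. a * f t) \<psi> = a *\<^sub>C borel_op f \<psi>"
  using assms by (intro cinner_eqI)
    (simp add: cinner_borel_op bounded_borel_scale cinner_scaleC_right spectral_form_scale)

lemma borel_op_sum:
  assumes "\<And>i. i \<in> I \<Longrightarrow> bounded_borel (f i)"
  shows "borel_op (\<lambda>t. \<Sum>i\<in>I. f i t) \<psi> = (\<Sum>i\<in>I. borel_op (f i) \<psi>)"
  using assms
proof (induction I rule: infinite_finite_induct)
  case (insert i I)
  then show ?case
    using borel_op_add[of "f i" "\<lambda>t. \<Sum>i\<in>I. f i t"] by (simp add: bounded_borel_sum)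
qed (use borel_op_scale[OF bounded_borel_const, of 0] in simp_all)

lemma clinear_borel_op: "bounded_borel f \<Longrightarrow> clinear_map (borel_op f)"
  unfolding clinear_map_def
  by (intro conjI allI cinner_eqI) (simp_all add: cinner_borel_op spectral_form_add_right
      cinner_add_right spectral_form_scaleC_right cinner_scaleC_right)

lemma borel_op_one: "borel_op (\<lambda>t. 1) \<psi> = \<psi>"
proof (rule cinner_eqI)
  fix \<eta>
  have *: "(\<lambda>t. 1) = (indicator UNIV :: real \<Rightarrow> complex)"
    by auto
  have "spectral_form E (\<lambda>t. 1) \<eta> \<psi> = cinner \<eta> \<psi>"
    unfolding * by (subst spectral_form_indicator) (simp_all add: E_UNIV)
  then show "cinner \<eta> (borel_op (\<lambda>t. 1) \<psi>) = cinner \<eta> \<psi>"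
    by (simp add: cinner_borel_op bounded_borel_const)
qed

text \<open>Induction on the first factor with the second fixed: for an indicator, the projection
  moves to the left argument of the form and then into the integrand.\<close>

lemma borel_op_mult:
  assumes f: "bounded_borel f" and g: "bounded_borel g"
  shows "borel_op (\<lambda>t. f t * g t) \<psi> = borel_op f (borel_op g \<psi>)"
proof (rule cinner_eqI)
  fix \<eta>
  have "spectral_form E (\<lambda>t. f t * g t) \<eta> \<psi> = spectral_form E f \<eta> (borel_op g \<psi>)"
    using f
  proof (induction rule: bounded_borel_induct)
    case (indicator B)
    then show ?case
      by (simp add: spectral_form_indicator E_adjoint cinner_borel_op[OF g] spectral_form_E_left[OF _ g])
  next
    case (add f f')
    then show ?case
      using g by (simp add: spectral_form_add distrib_right bounded_borel_mult)
  next
    case (scale a f)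
    then show ?case
      by (simp add: spectral_form_scale mult.assoc)
  next
    case (lim F f)
    have "uniform_limit UNIV (\<lambda>n t. F n t * g t) (\<lambda>t. f t * g t) sequentially"
      using lim(2,3) g
      by (intro uniform_lim_mult uniform_limit_const) (auto simp: bounded_borel_def)
    then have "(\<lambda>n. spectral_form E (\<lambda>t. F n t * g t) \<eta> \<psi>)
        \<longlonglongrightarrow> spectral_form E (\<lambda>t. f t * g t) \<eta> \<psi>"
      by (intro tendsto_spectral_form bounded_borel_mult g lim)
    then show ?case
      using LIMSEQ_unique[OF tendsto_spectral_form[OF lim(1,2,3)]] by (simp add: lim(4))
  qed
  then show "cinner \<eta> (borel_op (\<lambda>t. f t * g t) \<psi>) = cinner \<eta> (borel_op f (borel_op g \<psi>))"
    using f g by (simp add: cinner_borel_op bounded_borel_mult)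
qed

lemma cinner_borel_op_left:
  assumes "bounded_borel f"
  shows "cinner (borel_op f \<phi>) \<psi> = cinner \<phi> (borel_op (\<lambda>t. cnj (f t)) \<psi>)"
  using assms cinner_commute[of "borel_op f \<phi>" \<psi>]
  by (simp add: cinner_borel_op bounded_borel_cnj spectral_form_cnj)

section \<open>Unimodular functions, their inverses and integer powers\<close>

context
  fixes e :: "real \<Rightarrow> complex"
  assumes e: "bounded_borel e" and e_unit: "\<And>t. cmod (e t) = 1"
begin

lemma borel_op_unit_inverse:
  "borel_op (\<lambda>t. cnj (e t)) (borel_op e \<psi>) = \<psi>"
  "borel_op e (borel_op (\<lambda>t. cnj (e t)) \<psi>) = \<psi>"
proof -
  have "e t * cnj (e t) = 1" "cnj (e t) * e t = 1" for t
    using e_unit[of t] complex_norm_square[of "e t"] by (simp_all add: mult.commute)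
  then show "borel_op (\<lambda>t. cnj (e t)) (borel_op e \<psi>) = \<psi>"
    "borel_op e (borel_op (\<lambda>t. cnj (e t)) \<psi>) = \<psi>"
    using borel_op_mult[OF bounded_borel_cnj[OF e] e, of \<psi>]
      borel_op_mult[OF e bounded_borel_cnj[OF e], of \<psi>]
    by (simp_all add: borel_op_one)
qed

lemma bij_borel_op_unit: "bij (borel_op e)"
  by (rule o_bij[where g = "borel_op (\<lambda>t. cnj (e t))"]) (auto simp: fun_eq_iff borel_op_unit_inverse)

lemma inv_borel_op_unit: "inv (borel_op e) = borel_op (\<lambda>t. cnj (e t))"
  by (rule inv_unique_comp) (auto simp: fun_eq_iff borel_op_unit_inverse)

lemma unitary_borel_op: "unitary (borel_op e)"
  using clinear_borel_op[OF e] bij_is_surj[OF bij_borel_op_unit]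
  by (simp add: unitary_def cinner_borel_op_left[OF e] borel_op_unit_inverse)

end

lemma bounded_borel_power: "bounded_borel f \<Longrightarrow> bounded_borel (\<lambda>t. f t ^ n)"
  by (induction n) (simp_all add: bounded_borel_const bounded_borel_mult)

lemma borel_op_power: "bounded_borel f \<Longrightarrow> borel_op f ^^ n = borel_op (\<lambda>t. f t ^ n)"
  by (induction n) (auto simp: fun_eq_iff borel_op_one borel_op_mult bounded_borel_power)

lemma op_powi_borel_op:
  assumes "bounded_borel e" "\<And>t. cmod (e t) = 1"
  shows "op_powi (borel_op e) n = borel_op (\<lambda>t. e t powi n)"
proof -
  have "e t powi n = (if n \<ge> 0 then e t ^ nat n else cnj (e t) ^ nat (- n))" for t
    by (simp only: power_int_def inverse_eq_cnj[OF assms(2)])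
  then show ?thesis
    unfolding op_powi_def
    by (cases "n \<ge> 0")
      (simp_all only: inv_borel_op_unit[OF assms] borel_op_power[OF bounded_borel_cnj[OF assms(1)]]
        borel_op_power[OF assms(1)] if_True if_False)
qed

end

section \<open>Completeness of the oscillator space\<close>

lemma abs_rep_l2: "abs_l2 (rep_l2 \<psi>) = \<psi>"
  by (rule Quotient_abs_rep[OF Quotient_l2])

lemma square_integrable_rep_l2: "square_integrable (rep_l2 \<psi>)"
  using Quotient_rep_reflp[OF Quotient_l2, of \<psi>] by simp

lemma square_integrable_diff:
  "square_integrable f \<Longrightarrow> square_integrable g \<Longrightarrow> square_integrable (\<lambda>x. f x - g x)"
  using square_integrable_add[of f "\<lambda>x. -1 * g x"] square_integrable_scale[of g "-1"] by simp

lemma abs_l2_diff: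
  assumes "square_integrable f" "square_integrable g"
  shows "abs_l2 f - abs_l2 g = abs_l2 (\<lambda>x. f x - g x)"
proof -
  have "square_integrable (\<lambda>x. -1 * g x)"
    by (rule square_integrable_scale) fact
  with assms show ?thesis
    by (simp add: minus_l2_def uminus_l2_def scaleC_l2.abs_eq plus_l2.abs_eq)
qed

lemma ennreal_norm_abs_l2:
  assumes "square_integrable f"
  shows "ennreal ((norm (abs_l2 f))\<^sup>2) = (\<integral>\<^sup>+x. ennreal ((cmod (f x))\<^sup>2) \<partial>lborel)"
proof -
  have "cinner (abs_l2 f) (abs_l2 f) = (\<integral>x. cnj (f x) * f x \<partial>lborel)"
    by (rule cinner_l2.abs_eq) (use assms in auto)
  also have "\<dots> = (\<integral>x. complex_of_real ((cmod (f x))\<^sup>2) \<partial>lborel)"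
    by (simp only: complex_norm_square mult.commute)
  finally have "(norm (abs_l2 f))\<^sup>2 = (\<integral>x. (cmod (f x))\<^sup>2 \<partial>lborel)"
    by (simp add: power2_norm_eq_inner inner_Re_cinner)
  then show ?thesis
    using assms by (simp add: nn_integral_eq_integral square_integrable_def)
qed

text \<open>Riesz-Fischer: a rapidly convergent subsequence converges almost everywhere, and Fatou's
  lemma identifies the pointwise limit as the limit in norm.\<close>

instance l2 :: complete_space
proof
  fix X :: "nat \<Rightarrow> l2"
  assume X: "Cauchy X"
  have "\<exists>N. \<forall>m\<ge>N. \<forall>n\<ge>N. dist (X m) (X n) < (1 / 2) ^ k" for k
    using X by (simp add: Cauchy_def)
  then obtain N where N: "\<And>k m n. m \<ge> N k \<Longrightarrow> n \<ge> N k \<Longrightarrow> dist (X m) (X n) < (1 / 2) ^ k"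
    by metis
  \<comment> \<open>The summand k makes r strictly increasing; the sum makes \<open>r m\<close> at
    least \<open>N k\<close> for every \<open>k \<le> m\<close>.\<close>
  define r where "r k = k + (\<Sum>j\<le>k. N j)" for k
  have r: "strict_mono r"
    by (rule strict_monoI_Suc) (simp add: r_def)
  have "N k \<le> r m" if "k \<le> m" for k m
  proof -
    have "N k \<le> (\<Sum>j\<le>m. N j)"
      using that by (intro member_le_sum) auto
    then show ?thesis
      by (simp add: r_def)
  qed
  then have close: "dist (X (r m)) (X (r n)) < (1 / 2) ^ k" if "k \<le> m" "k \<le> n" for k m n
    using N that by blast
  define f where "f k = rep_l2 (X (r k))" for k
  have sq: "square_integrable (f k)" for k
    by (simp add: f_def square_integrable_rep_l2)
  then have [measurable]: "f k \<in> borel_measurable borel" for k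
    by (simp add: square_integrable_def)
  have X_f: "X (r k) = abs_l2 (f k)" for k
    by (simp add: f_def abs_rep_l2)
  have norm_diff: "(\<integral>\<^sup>+x. ennreal ((cmod (f m x - f n x))\<^sup>2) \<partial>lborel) \<le> ennreal (((1 / 2) ^ k)\<^sup>2)"
    if "k \<le> m" "k \<le> n" for k m n
  proof -
    have "(\<integral>\<^sup>+x. ennreal ((cmod (f m x - f n x))\<^sup>2) \<partial>lborel) = ennreal ((dist (X (r m)) (X (r n)))\<^sup>2)"
      using sq by (simp add: X_f dist_norm abs_l2_diff ennreal_norm_abs_l2 square_integrable_diff)
    also have "\<dots> \<le> ennreal (((1 / 2) ^ k)\<^sup>2)"
      using close[OF that] by (intro ennreal_leI power_mono) auto
    finally show ?thesis .
  qed
  \<comment> \<open>The weights \<open>2 ^ k\<close> make the increments summable pointwise without Minkowski's inequality.\<close>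
  let ?w = "\<lambda>k x. ennreal (2 ^ k * (cmod (f (Suc k) x - f k x))\<^sup>2)"
  have "(\<integral>\<^sup>+x. (\<Sum>k. ?w k x) \<partial>lborel) = (\<Sum>k. \<integral>\<^sup>+x. ?w k x \<partial>lborel)"
    by (rule nn_integral_suminf) measurable
  also have "\<dots> \<le> (\<Sum>k. ennreal ((1 / 2) ^ k))"
  proof (intro suminf_le summableI)
    fix k
    have "(\<integral>\<^sup>+x. ?w k x \<partial>lborel) = ennreal (2 ^ k) * (\<integral>\<^sup>+x. ennreal ((cmod (f (Suc k) x - f k x))\<^sup>2) \<partial>lborel)"
      by (simp add: ennreal_mult nn_integral_cmult)
    also have "\<dots> \<le> ennreal (2 ^ k) * ennreal (((1 / 2) ^ k)\<^sup>2)"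
      by (intro mult_left_mono norm_diff) auto
    also have "\<dots> = ennreal ((1 / 2) ^ k)"
      by (simp add: power2_eq_square power_one_over flip: ennreal_mult)
    finally show "(\<integral>\<^sup>+x. ?w k x \<partial>lborel) \<le> ennreal ((1 / 2) ^ k)" .
  qed
  also have "\<dots> < \<infinity>"
    by (subst suminf_ennreal2) (auto intro: summable_geometric)
  finally have "AE x in lborel. (\<Sum>k. ?w k x) \<noteq> \<infinity>"
    by (intro nn_integral_noteq_infinite) auto
  then have conv: "AE x in lborel. convergent (\<lambda>k. f k x)"
  proof (rule AE_mp, intro AE_I2 impI)
    fix x
    assume "(\<Sum>k. ?w k x) \<noteq> \<infinity>"
    then have "summable (\<lambda>k. 2 ^ k * (cmod (f (Suc k) x - f k x))\<^sup>2)"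
      by (intro summable_suminf_not_top) auto
    \<comment> \<open>Boundedness of the weighted squares already forces the increments to decay
      like \<open>(1 / sqrt 2) ^ k\<close>.\<close>
    then have "Bseq (\<lambda>k. 2 ^ k * (cmod (f (Suc k) x - f k x))\<^sup>2)"
      by (intro convergent_imp_Bseq convergentI[where L = 0] summable_LIMSEQ_zero)
    then obtain C where C: "C > 0" "\<And>k. 2 ^ k * (cmod (f (Suc k) x - f k x))\<^sup>2 \<le> C"
      by (auto elim!: BseqE)
    have "summable (\<lambda>k. f (Suc k) x - f k x)"
    proof (rule summable_comparison_test)
      have "cmod (f (Suc k) x - f k x) \<le> sqrt C * (1 / sqrt 2) ^ k" for k
      proof (rule power2_le_imp_le)
        have "(cmod (f (Suc k) x - f k x))\<^sup>2 \<le> C / 2 ^ k"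
          using C(2)[of k] by (simp add: field_simps)
        also have "(2 :: real) ^ k = (sqrt 2 ^ k)\<^sup>2"
          by (simp only: power_mult[symmetric] mult.commute[of k]) (simp only: power_mult, simp)
        also have "C / (sqrt 2 ^ k)\<^sup>2 = (sqrt C * (1 / sqrt 2) ^ k)\<^sup>2"
          using C(1) by (simp add: power_divide)
        finally show "(cmod (f (Suc k) x - f k x))\<^sup>2 \<le> (sqrt C * (1 / sqrt 2) ^ k)\<^sup>2" .
      qed (use C(1) in simp)
      then show "\<exists>K. \<forall>k\<ge>K. norm (f (Suc k) x - f k x) \<le> sqrt C * (1 / sqrt 2) ^ k"
        by auto
      show "summable (\<lambda>k. sqrt C * (1 / sqrt 2) ^ k)"
        by (intro summable_mult summable_geometric) simp
    qed
    then have "convergent (\<lambda>n. \<Sum>k<n. f (Suc k) x - f k x)"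
      by (simp add: summable_iff_convergent)
    then have "convergent (\<lambda>n. f n x - f 0 x)"
      by (simp only: sum_lessThan_telescope[of "\<lambda>k. f k x"])
    then show "convergent (\<lambda>k. f k x)"
      by (simp add: convergent_diff_const_right_iff)
  qed
  \<comment> \<open>Where the sequence diverges, \<open>lim\<close> returns some default; this
    happens only on a null set, and g is still Borel measurable.\<close>
  define g where "g x = lim (\<lambda>k. f k x)" for x
  have [measurable]: "g \<in> borel_measurable borel"
    unfolding g_def by measurable
  have f_g: "AE x in lborel. (\<lambda>k. f k x) \<longlonglongrightarrow> g x"
    using conv by eventually_elim (simp add: g_def convergent_LIMSEQ_iff)
  \<comment> \<open>Fatou's lemma in m, with k fixed.\<close>
  have g_f: "(\<integral>\<^sup>+x. ennreal ((cmod (g x - f k x))\<^sup>2) \<partial>lborel) \<le> ennreal (((1 / 2) ^ k)\<^sup>2)" for k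
  proof -
    have "(\<integral>\<^sup>+x. ennreal ((cmod (g x - f k x))\<^sup>2) \<partial>lborel)
        = (\<integral>\<^sup>+x. liminf (\<lambda>m. ennreal ((cmod (f m x - f k x))\<^sup>2)) \<partial>lborel)"
    proof (rule nn_integral_cong_AE)
      show "AE x in lborel. ennreal ((cmod (g x - f k x))\<^sup>2)
          = liminf (\<lambda>m. ennreal ((cmod (f m x - f k x))\<^sup>2))"
        using f_g
      proof eventually_elim
        case (elim x)
        then have "(\<lambda>m. ennreal ((cmod (f m x - f k x))\<^sup>2)) \<longlonglongrightarrow> ennreal ((cmod (g x - f k x))\<^sup>2)"
          by (intro tendsto_intros)
        then show ?case
          by (intro lim_imp_Liminf[symmetric] trivial_limit_sequentially)
      qed
    qed
    also have "\<dots> \<le> liminf (\<lambda>m. \<integral>\<^sup>+x. ennreal ((cmod (f m x - f k x))\<^sup>2) \<partial>lborel)"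
      by (rule nn_integral_liminf) measurable
    also have "\<dots> \<le> limsup (\<lambda>m. \<integral>\<^sup>+x. ennreal ((cmod (f m x - f k x))\<^sup>2) \<partial>lborel)"
      by (rule Liminf_le_Limsup) simp
    also have "\<dots> \<le> ennreal (((1 / 2) ^ k)\<^sup>2)"
      by (rule Limsup_bounded) (auto simp: eventually_sequentially intro!: exI[of _ k] norm_diff)
    finally show ?thesis .
  qed
  have sq_diff: "square_integrable (\<lambda>x. g x - f k x)" for k
  proof -
    have "(\<integral>\<^sup>+x. ennreal (norm ((cmod (g x - f k x))\<^sup>2)) \<partial>lborel) < \<infinity>"
      using le_less_trans[OF g_f[of k]] by simp
    then show ?thesis
      unfolding square_integrable_def by (intro conjI integrableI_bounded) simp_all
  qed
  have sq_g: "square_integrable g"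
    using square_integrable_add[OF sq_diff[of 0] sq[of 0]] by simp
  have "(\<lambda>k. X (r k)) \<longlonglongrightarrow> abs_l2 g"
  proof (rule metric_LIMSEQ_I)
    fix e :: real
    assume "e > 0"
    then obtain K where K: "(1 / 2) ^ K < e"
      using real_arch_pow_inv[of e "1 / 2"] by auto
    have "dist (X (r k)) (abs_l2 g) < e" if "k \<ge> K" for k
    proof -
      have "ennreal ((dist (abs_l2 g) (X (r k)))\<^sup>2) \<le> ennreal (((1 / 2) ^ k)\<^sup>2)"
        using g_f[of k] sq_diff[of k] by (simp add: dist_norm X_f abs_l2_diff sq sq_g ennreal_norm_abs_l2)
      then have "(dist (abs_l2 g) (X (r k)))\<^sup>2 \<le> ((1 / 2) ^ k)\<^sup>2"
        by (simp add: ennreal_le_iff)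
      then have "dist (abs_l2 g) (X (r k)) \<le> (1 / 2) ^ k"
        by (rule power2_le_imp_le) simp
      also have "\<dots> \<le> (1 / 2) ^ K"
        using that by (intro power_decreasing) auto
      finally show ?thesis
        using K by (simp add: dist_commute)
    qed
    then show "\<exists>K. \<forall>k\<ge>K. dist (X (r k)) (abs_l2 g) < e"
      by blast
  qed
  then show "convergent X"
    using Cauchy_converges_subseq[OF X r] by (auto simp: comp_def convergent_def)
qed

section \<open>The spectral measure of \<open>h \<otimes> \<sigma>\<^sub>z\<close>\<close>

context pvm
begin

lemma integrable_spectral_dist_zero:
  fixes f :: "real \<Rightarrow> 'b::{banach, second_countable_topology}"
  assumes f: "f \<in> borel_measurable borel"
  shows "integrable (spectral_dist E 0) f"
proof -
  have [measurable]: "f \<in> borel_measurable (spectral_dist E 0)"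
    using f by (simp cong: measurable_cong_sets)
  have "(\<integral>\<^sup>+x. ennreal (norm (f x)) \<partial>spectral_dist E (0 *\<^sub>C 0)) = 0"
    unfolding spectral_dist_scaleC by (subst nn_integral_scale_measure) simp_all
  then show ?thesis
    by (simp add: integrable_iff_bounded)
qed

lemma spectral_form_zero_left: "spectral_form E f 0 \<psi> = 0"
  by (simp add: spectral_form_def sum_4 power3_eq_cube)

text \<open>The lower block is reflected because \<open>pauli_z\<close> turns h into
  \<open>- h\<close> there, and negation carries the spectral measure to its preimages.\<close>

definition spin :: "real set \<Rightarrow> 'a \<times> 'a \<Rightarrow> 'a \<times> 'a" where
  "spin B = block (E B) (\<lambda>\<psi>. 0) (\<lambda>\<psi>. 0) (E (uminus -` B))"

lemma spin_apply: "spin B (u, v) = (E B u, E (uminus -` B) v)"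
  by (simp add: spin_def block_def)

lemma uminus_vimage_borel: "B \<in> sets borel \<Longrightarrow> uminus -` B \<in> sets (borel :: real measure)"
  using measurable_sets_borel[of uminus borel B] by simp

lemma projection_valued_measure_spin: "projection_valued_measure spin"
  unfolding projection_valued_measure_def
proof (intro conjI ballI allI impI)
  fix B :: "real set"
  assume B: "B \<in> sets borel"
  note B' = B uminus_vimage_borel[OF B]
  show "orth_projection (spin B)"
    using proj[OF B'(1)] proj[OF B'(2)]
    by (auto simp: orth_projection_def clinear_map_def spin_apply fun_eq_iff cinner_prod_def
        scaleC_prod_def)
  fix C :: "real set"
  assume C: "C \<in> sets borel"
  show "spin (B \<inter> C) = spin B \<circ> spin C"
    using B' C uminus_vimage_borel[OF C] by (auto simp: fun_eq_iff spin_apply E_Int)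
next
  fix A :: "nat \<Rightarrow> real set" and \<psi> :: "'a \<times> 'a"
  assume A: "range A \<subseteq> sets borel" "disjoint_family A"
  then have A': "range (\<lambda>n. uminus -` A n) \<subseteq> sets borel" "disjoint_family (\<lambda>n. uminus -` A n)"
    using uminus_vimage_borel by (auto simp: disjoint_family_on_def)
  obtain u v where \<psi>: "\<psi> = (u, v)"
    by fastforce
  have "(\<lambda>n. (\<Sum>i<n. E (A i) u, \<Sum>i<n. E (uminus -` A i) v))
      \<longlonglongrightarrow> (E (\<Union>n. A n) u, E (\<Union>n. uminus -` A n) v)"
    using E_sums[OF A] E_sums[OF A'] unfolding sums_def by (intro tendsto_Pair)
  moreover have "(\<Sum>i<n. spin (A i) \<psi>) = (\<Sum>i<n. E (A i) u, \<Sum>i<n. E (uminus -` A i) v)" for n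
    by (simp add: \<psi> spin_apply prod_eq_iff fst_sum snd_sum)
  ultimately show "(\<lambda>n. spin (A n) \<psi>) sums spin (\<Union>n. A n) \<psi>"
    by (simp add: sums_def \<psi> spin_apply vimage_UN)
qed (auto simp: fun_eq_iff spin_apply E_empty E_UNIV zero_prod_def)

lemma pvm_spin: "pvm spin"
  by (rule pvm.intro) (rule projection_valued_measure_spin)

abbreviation reflected :: "'a \<Rightarrow> real measure" where
  "reflected \<psi> \<equiv> distr (spectral_dist E \<psi>) borel uminus"

text \<open>Pythagoras in the product space. Every integral against the distributions of
  \<open>spin\<close> splits through this.\<close>

lemma emeasure_spectral_dist_spin:
  assumes "B \<in> sets borel"
  shows "emeasure (spectral_dist spin (u, v)) B
    = emeasure (spectral_dist E u) B + emeasure (reflected v) B"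
  using assms uminus_vimage_borel[OF assms]
  by (simp add: pvm.emeasure_spectral_dist[OF pvm_spin] emeasure_spectral_dist spin_apply norm_Pair
      emeasure_distr cong: measurable_cong_sets)

lemma integrable_reflected:
  fixes f :: "real \<Rightarrow> 'b::{banach, second_countable_topology}"
  assumes f: "f \<in> borel_measurable borel"
  shows "integrable (reflected v) f \<longleftrightarrow> integrable (spectral_dist E v) (\<lambda>t. f (- t))"
  by (rule integrable_distr_eq) (use f in \<open>simp_all cong: measurable_cong_sets\<close>)

lemma integrable_spectral_dist_spin:
  fixes f :: "real \<Rightarrow> 'b::{banach, second_countable_topology}"
  assumes f: "f \<in> borel_measurable borel"
  shows "integrable (spectral_dist spin (u, v)) f
    \<longleftrightarrow> integrable (spectral_dist E u) f \<and> integrable (spectral_dist E v) (\<lambda>t. f (- t))"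
  unfolding integrable_reflected[OF f, symmetric]
  by (rule integrable_add_measure[OF f]) (simp_all add: emeasure_spectral_dist_spin)

lemma integral_spectral_dist_spin:
  fixes f :: "real \<Rightarrow> complex"
  assumes f: "f \<in> borel_measurable borel"
    and int: "integrable (spectral_dist E u) f" "integrable (spectral_dist E v) (\<lambda>t. f (- t))"
  shows "(\<integral>t. f t \<partial>spectral_dist spin (u, v))
    = (\<integral>t. f t \<partial>spectral_dist E u) + (\<integral>t. f (- t) \<partial>spectral_dist E v)"
proof -
  have "(\<integral>t. f t \<partial>spectral_dist spin (u, v)) = (\<integral>t. f t \<partial>spectral_dist E u) + (\<integral>t. f t \<partial>reflected v)"
    by (rule complex_integral_add_measure[OF f])
      (simp_all add: emeasure_spectral_dist_spin integrable_reflected[OF f] int)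
  also have "(\<integral>t. f t \<partial>reflected v) = (\<integral>t. f (- t) \<partial>spectral_dist E v)"
    by (rule integral_distr) (use f in \<open>simp_all cong: measurable_cong_sets\<close>)
  finally show ?thesis .
qed

text \<open>Splitting requires integrability at all four polarization vectors; it follows because
  the vectors with integrable f form a subspace.\<close>

lemma spectral_form_spin:
  fixes f :: "real \<Rightarrow> complex"
  assumes f: "f \<in> borel_measurable borel"
    and int: "integrable (spectral_dist E \<eta>) f" "integrable (spectral_dist E u) f"
      "integrable (spectral_dist E \<zeta>) (\<lambda>t. f (- t))" "integrable (spectral_dist E v) (\<lambda>t. f (- t))"
  shows "spectral_form spin f (\<eta>, \<zeta>) (u, v)
    = spectral_form E f \<eta> u + spectral_form E (\<lambda>t. f (- t)) \<zeta> v"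
proof -
  have "(u, v) + a *\<^sub>C (\<eta>, \<zeta>) = (u + a *\<^sub>C \<eta>, v + a *\<^sub>C \<zeta>)" for a
    by (simp add: scaleC_prod_def)
  then have "(\<integral>t. f t \<partial>spectral_dist spin ((u, v) + a *\<^sub>C (\<eta>, \<zeta>)))
      = (\<integral>t. f t \<partial>spectral_dist E (u + a *\<^sub>C \<eta>)) + (\<integral>t. f (- t) \<partial>spectral_dist E (v + a *\<^sub>C \<zeta>))" for a
    by (simp only:)
      (intro integral_spectral_dist_spin f integrable_spectral_dist_add int
        integrable_spectral_dist_scaleC)
  then show ?thesis
    by (simp add: spectral_form_def sum.distrib distrib_left add_divide_distrib)
qed

text \<open>The identity function is unbounded, so domains must match: reflection preserves
  \<open>t\<^sup>2\<close>, which makes the domain \<open>D \<times> D\<close>. Test vectors with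
  one zero component separate the weak equation into its two blocks.\<close>

lemma spectral_integral_spin:
  "spectral_integral spin complex_of_real
    = qubit_tensor (spectral_integral E complex_of_real) pauli_z"
proof -
  define D where "D = spectral_domain E complex_of_real"
  have D_iff: "\<psi> \<in> D \<longleftrightarrow> integrable (spectral_dist E \<psi>) (\<lambda>t. t\<^sup>2)" for \<psi>
    by (simp add: D_def spectral_domain_def)
  have dom: "(u, v) \<in> spectral_domain spin complex_of_real \<longleftrightarrow> u \<in> D \<and> v \<in> D" for u v
    by (simp add: spectral_domain_def D_iff integrable_spectral_dist_spin)
  \<comment> \<open>Spectral distributions are finite, so square integrability implies
    integrability, here through \<open>\<bar>t\<bar> \<le> 1 + t\<^sup>2\<close>.\<close>
  have int: "integrable (spectral_dist E \<psi>) complex_of_real" if "\<psi> \<in> D" for \<psi>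
  proof (rule Bochner_Integration.integrable_bound)
    show "integrable (spectral_dist E \<psi>) (\<lambda>t. 1 + t\<^sup>2)"
      using that by (simp add: D_iff)
    have "\<bar>t\<bar> \<le> 1 + t\<^sup>2" for t :: real
      using zero_le_power2[of "\<bar>t\<bar> - 1"] by (simp add: power2_eq_square algebra_simps)
    then show "AE t in spectral_dist E \<psi>. norm (complex_of_real t) \<le> norm (1 + t\<^sup>2)"
      by (auto intro: order.trans)
  qed (simp cong: measurable_cong_sets)
  then have int': "integrable (spectral_dist E \<psi>) (\<lambda>t. complex_of_real (- t))" if "\<psi> \<in> D" for \<psi>
    using that by simp
  have form: "spectral_form spin complex_of_real (\<eta>, \<zeta>) (u, v)
      = spectral_form E complex_of_real \<eta> u - spectral_form E complex_of_real \<zeta> v"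
    if "\<eta> \<in> D" "\<zeta> \<in> D" "u \<in> D" "v \<in> D" for \<eta> \<zeta> u v
    using spectral_form_spin[of complex_of_real \<eta> u \<zeta> v] that
      spectral_form_scale[of "-1" complex_of_real \<zeta> v] by (simp add: int int')
  have zero: "0 \<in> D"
    unfolding D_iff by (rule integrable_spectral_dist_zero) simp
  have gate: "qubit_gate pauli_z (u, v) = (u, - v)" for u v :: 'a
    by (simp add: qubit_gate_def block_def pauli_z_def vector_2 scaleC_minus_one)
  have mem: "(\<psi>, \<phi>) \<in> spectral_integral E complex_of_real
      \<longleftrightarrow> \<psi> \<in> D \<and> (\<forall>\<eta>\<in>D. spectral_form E complex_of_real \<eta> \<psi> = cinner \<eta> \<phi>)" for \<psi> \<phi>
    by (auto simp: spectral_integral_def D_def)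
  have "((u, v), (u', v')) \<in> spectral_integral spin complex_of_real
      \<longleftrightarrow> (u, u') \<in> spectral_integral E complex_of_real
        \<and> (v, - v') \<in> spectral_integral E complex_of_real" (is "?L \<longleftrightarrow> ?R") for u v u' v'
  proof
    assume L: ?L
    then have uv: "u \<in> D" "v \<in> D"
      by (auto simp: spectral_integral_def dom)
    have L': "cinner \<eta> u' + cinner \<zeta> v'
        = spectral_form E complex_of_real \<eta> u - spectral_form E complex_of_real \<zeta> v"
      if "\<eta> \<in> D" "\<zeta> \<in> D" for \<eta> \<zeta>
    proof -
      have "cinner (\<eta>, \<zeta>) (u', v') = spectral_form spin complex_of_real (\<eta>, \<zeta>) (u, v)"
        using L that by (auto simp: spectral_integral_def dom)
      then show ?thesis
        using that uv by (simp add: form cinner_prod_def)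
    qed
    show ?R
      unfolding mem using uv L'[OF _ zero] L'[OF zero]
      by (auto simp: spectral_form_zero_left cinner_minus_right)
  next
    assume R: ?R
    show ?L
      using R[unfolded mem] unfolding spectral_integral_def
      by (auto simp: dom form cinner_prod_def cinner_minus_right)
  qed
  moreover have "((u, v), (u', v')) \<in> qubit_tensor T pauli_z \<longleftrightarrow> (u, u') \<in> T \<and> (v, - v') \<in> T"
    for u v u' v' :: 'a and T
    unfolding qubit_tensor_def gate by (auto intro: exI[of _ "- v'"])
  ultimately show ?thesis
    by auto
qed

end

text \<open>The form splits by \<open>spectral_form_spin\<close>, and each summand is represented by
  the corresponding diagonal entry.\<close>

lemma (in complete_pvm) spectral_integral_spin_bounded:
  assumes f: "bounded_borel f"
  shows "op_graph (block (borel_op f) (\<lambda>\<psi>. 0) (\<lambda>\<psi>. 0) (borel_op (\<lambda>t. f (- t))))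
    \<subseteq> spectral_integral spin f"
proof -
  have f': "bounded_borel (\<lambda>t. f (- t))"
    using f by (auto simp: bounded_borel_def bounded_iff)
  have [measurable]: "f \<in> borel_measurable borel"
    using f by (rule bounded_borel_measurable)
  have "spectral_domain spin f = UNIV"
    using pvm.integrable_bounded_borel[OF pvm_spin f, THEN integrable_norm]
      pvm.integrable_bounded_borel[OF pvm_spin bounded_borel_mult[OF f f], THEN integrable_norm]
    by (auto simp: spectral_domain_def norm_mult power2_eq_square)
  then show ?thesis
    using f f' by (auto simp: op_graph_def block_def spectral_integral_def cinner_prod_def
        cinner_borel_op spectral_form_spin integrable_bounded_borel)
qed

section \<open>The operators generated by \<open>h\<close>\<close>

lemma op_graph_eqD: "op_graph A \<subseteq> op_graph B \<Longrightarrow> A = B"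
  by (auto simp: op_graph_def)

definition phase :: "real \<Rightarrow> complex" where
  "phase t = exp (- (\<i> * of_real t))"

lemma cmod_phase [simp]: "cmod (phase t) = 1"
  by (simp add: phase_def)

lemma bounded_borel_phase: "bounded_borel phase"
proof (rule bounded_borelI[where K = 1])
  show "phase \<in> borel_measurable borel"
    unfolding phase_def[abs_def] by measurable
qed simp

lemma phase_minus: "phase (- t) = cnj (phase t)" "1 / phase t = cnj (phase t)"
  by (simp_all add: phase_def exp_cnj exp_minus inverse_eq_divide)

lemma phase_power_int: "phase t powi n = exp (- (\<i> * of_real t * of_int n))"
proof -
  have "phase t powi n = exp (of_int n * (- (\<i> * of_real t)))"
    unfolding phase_def by (rule exp_power_int)
  then show ?thesis
    by (simp add: mult.commute mult.left_commute)
qed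

text \<open>
  Uniqueness of the spectral measure is not needed: every spectral measure yields a total operator,
  and its graph is contained in that of \<open>\<omega>\<close> or \<open>Wz\<close>.
\<close>

lemma generated_operators:
  fixes h :: "'a::{complex_inner, complete_space} operator"
  assumes \<omega>: "op_graph \<omega> = fun_calc h phase"
    and Wz: "op_graph Wz = fun_calc (qubit_tensor h pauli_z) phase"
  obtains E where "complete_pvm E"
    and "\<omega> = complete_pvm.borel_op E phase"
    and "Wz = block \<omega> (\<lambda>\<psi>. 0) (\<lambda>\<psi>. 0) (inv \<omega>)"
    and "\<And>n. op_graph (op_powi \<omega> n) = fun_calc h (\<lambda>t. phase t powi n)"
proof -
  \<comment> \<open>The graph of a total map is nonempty, hence so is the union defining
    \<open>fun_calc\<close>; this is where a spectral measure of h comes from.\<close>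
  have ex: "\<exists>E. spectral_measure_of h E"
    using \<omega> by (auto simp: op_graph_def fun_calc_def)
  have cpvm: "complete_pvm E" if "spectral_measure_of h E" for E
    using that by (simp add: spectral_measure_of_def complete_pvm_def pvm_def)
  have \<omega>_eq: "complete_pvm.borel_op E phase = \<omega>" if E: "spectral_measure_of h E" for E
  proof (rule op_graph_eqD)
    show "op_graph (complete_pvm.borel_op E phase) \<subseteq> op_graph \<omega>"
      unfolding \<omega> fun_calc_def
      using E complete_pvm.spectral_integral_eq_op_graph[OF cpvm[OF E] bounded_borel_phase] by auto
  qed
  \<comment> \<open>Shown for every spectral measure, because \<open>fun_calc\<close> is the union
    over all of them.\<close>
  have powers: "spectral_integral E (\<lambda>t. phase t powi n) = op_graph (op_powi \<omega> n)"
    if E: "spectral_measure_of h E" for E n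
  proof -
    have "bounded_borel (\<lambda>t. phase t powi n)"
      by (rule bounded_borelI[where K = 1])
        (simp_all add: norm_power_int phase_power_int)
    then show ?thesis
      using complete_pvm.spectral_integral_eq_op_graph[OF cpvm[OF E]]
        complete_pvm.op_powi_borel_op[OF cpvm[OF E] bounded_borel_phase] \<omega>_eq[OF E] by simp
  qed
  from ex obtain E where E: "spectral_measure_of h E" ..
  interpret complete_pvm E
    by (rule cpvm[OF E])
  have "spectral_measure_of (qubit_tensor h pauli_z) spin"
    using E spectral_integral_spin projection_valued_measure_spin
    by (simp add: spectral_measure_of_def)
  then have "block (borel_op phase) (\<lambda>\<psi>. 0) (\<lambda>\<psi>. 0) (borel_op (\<lambda>t. phase (- t))) = Wz"
    using spectral_integral_spin_bounded[OF bounded_borel_phase]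
    by (intro op_graph_eqD) (auto simp: Wz fun_calc_def)
  moreover have "op_graph (op_powi \<omega> n) = fun_calc h (\<lambda>t. phase t powi n)" for n
    using E powers by (auto simp: fun_calc_def)
  ultimately show ?thesis
    using that[OF complete_pvm_axioms] \<omega>_eq[OF E] inv_borel_op_unit[OF bounded_borel_phase]
    by (simp add: phase_minus)
qed

section \<open>A real Fejer-Riesz theorem\<close>

text \<open>Evaluating real polynomials at complex points keeps reality of the coefficients in the
  type instead of in side conditions.\<close>

definition cpoly :: "real poly \<Rightarrow> complex \<Rightarrow> complex" where
  "cpoly p z = poly (map_poly complex_of_real p) z"

lemma cpoly_0 [simp]: "cpoly 0 z = 0"
  by (simp add: cpoly_def)

lemma cpoly_pCons [simp]: "cpoly (pCons a p) z = of_real a + z * cpoly p z"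
  by (simp add: cpoly_def map_poly_pCons)

lemma cpoly_add [simp]: "cpoly (p + q) z = cpoly p z + cpoly q z"
  by (induction p q rule: poly_induct2) (simp_all add: algebra_simps)

lemma cpoly_smult [simp]: "cpoly (smult a p) z = of_real a * cpoly p z"
  by (induction p) (simp_all add: algebra_simps)

lemma cpoly_mult [simp]: "cpoly (p * q) z = cpoly p z * cpoly q z"
  by (induction p) (simp_all add: algebra_simps)

lemma cpoly_diff [simp]: "cpoly (p - q) z = cpoly p z - cpoly q z"
  using cpoly_add[of p "- q" z] cpoly_smult[of "-1" q z] by simp

lemma cpoly_sum: "cpoly (\<Sum>i\<in>I. p i) z = (\<Sum>i\<in>I. cpoly (p i) z)"
  by (induction I rule: infinite_finite_induct) simp_all

lemma cpoly_of_real: "cpoly p (of_real x) = of_real (poly p x)"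
  by (induction p) simp_all

lemma cpoly_altdef: "degree p \<le> d \<Longrightarrow> cpoly p z = (\<Sum>k\<le>d. of_real (coeff p k) * z ^ k)"
  unfolding cpoly_def poly_altdef
  by (rule sum.mono_neutral_cong_left) (auto simp: coeff_map_poly degree_map_poly coeff_eq_0)

lemma ex_cpoly_root:
  assumes "degree p > 0"
  obtains c where "cpoly p c = 0"
proof -
  have "\<not> constant (poly (map_poly complex_of_real p))"
    using assms by (simp add: constant_degree degree_map_poly)
  then show ?thesis
    using fundamental_theorem_of_algebra that unfolding cpoly_def by blast
qed

text \<open>The equation is \<open>b\<^sup>2 - c * b + 1 = 0\<close>, whose constant term excludes
  \<open>b = 0\<close>.\<close>

lemma ex_joukowski_preimage:
  obtains b :: complex where "b \<noteq> 0" "b + 1 / b = c"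
proof -
  have "degree [:1, - c, 1:] = 2"
    by simp
  then have "\<not> constant (poly [:1, - c, 1:])"
    by (simp add: constant_degree)
  then obtain b where b: "poly [:1, - c, 1:] b = 0"
    using fundamental_theorem_of_algebra by blast
  then have "b \<noteq> 0"
    by auto
  moreover from this have "b + 1 / b = c"
    using b by (simp add: field_simps)
  ultimately show ?thesis
    using that by blast
qed

text \<open>Outside \<open>[-2, 2]\<close> the discriminant \<open>x\<^sup>2 - 4\<close> is
  positive, so the preimage can be taken real.\<close>

lemma ex_real_joukowski_preimage:
  assumes "\<bar>x\<bar> > 2"
  obtains b :: real where "b \<noteq> 0" "b + 1 / b = x"
proof -
  define s where "s = sqrt (x\<^sup>2 - 4)"
  have "x\<^sup>2 > 2\<^sup>2"
    using assms by (metis abs_numeral abs_le_square_iff not_le)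
  then have s: "s\<^sup>2 = x\<^sup>2 - 4"
    by (simp add: s_def)
  define b where "b = (x + s) / 2"
  have b: "b * b - x * b + 1 = 0"
    using s by (simp add: b_def field_simps power2_eq_square)
  then have "b \<noteq> 0"
    by auto
  moreover from this have "b + 1 / b = x"
    using b by (simp add: field_simps)
  ultimately show ?thesis
    using that by blast
qed

text \<open>The divisor is the real quadratic with roots c and \<open>cnj c\<close>. The remainder
  is real of degree at most one, and such a polynomial vanishes at a nonreal point only if it is
  zero.\<close>

lemma dvd_of_nonreal_root:
  assumes root: "cpoly p c = 0" and c: "Im c \<noteq> 0"
  shows "[:(cmod c)\<^sup>2, - 2 * Re c, 1:] dvd p"
proof -
  define Q where "Q = [:(cmod c)\<^sup>2, - 2 * Re c, 1:]"
  have Q: "cpoly Q c = 0"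
    by (simp add: Q_def complex_eq_iff cmod_def power2_eq_square algebra_simps)
  have degQ: "degree Q = 2"
    by (simp add: Q_def)
  define R where "R = p mod Q"
  have "cpoly p c = cpoly (Q * (p div Q) + R) c"
    by (simp add: R_def)
  then have R: "cpoly R c = 0"
    using root Q by simp
  have "Q \<noteq> 0"
    by (simp add: Q_def)
  then have "degree R < 2 \<or> R = 0"
    unfolding R_def using degree_mod_less[of Q p] degQ by auto
  then have "degree R \<le> 1"
    by auto
  then have "cpoly R c = of_real (coeff R 0) + of_real (coeff R 1) * c"
    by (subst cpoly_altdef[where d = 1]) simp_all
  then have "coeff R 1 = 0" "coeff R 0 = 0"
    using R c by (auto simp: complex_eq_iff)
  then have "R = 0"
    using \<open>degree R \<le> 1\<close> by (metis One_nat_def le_Suc_eq le_zero_eq leading_coeff_0_iff)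
  then show ?thesis
    unfolding R_def Q_def by (simp add: mod_eq_0_iff_dvd)
qed

text \<open>
  Each root \<open>c = b + 1 / b\<close> of \<open>r\<close> contributes a factor \<open>(1 - b w) (1 - b / w) / b\<close>; nonreal roots are
  taken in conjugate pairs to keep the coefficients real.
\<close>

theorem fejer_riesz:
  fixes r :: "real poly"
  assumes "\<And>y. \<bar>y\<bar> \<le> 2 \<Longrightarrow> poly r y > 0"
  shows "\<exists>q::real poly. degree q \<le> degree r \<and> (\<forall>w. w \<noteq> 0 \<longrightarrow> cpoly r (w + 1 / w) = cpoly q w * cpoly q (1 / w))"
  using assms
proof (induction "degree r" arbitrary: r rule: less_induct)
  case less
  \<comment> \<open>Common to both kinds of roots: a factor L with its own factorization is split
    off, and the cofactor, still positive on \<open>[-2, 2]\<close>, goes to the induction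
    hypothesis.\<close>
  have step: ?case
    if r: "r = L * s" "L \<noteq> 0" "degree L > 0" and s: "\<And>y. \<bar>y\<bar> \<le> 2 \<Longrightarrow> poly s y > 0"
      and L: "degree l \<le> degree L" "\<And>w. w \<noteq> 0 \<Longrightarrow> cpoly L (w + 1 / w) = cpoly l w * cpoly l (1 / w)"
    for L s l
  proof -
    have "s \<noteq> 0"
      using s[of 0] by auto
    then have deg: "degree r = degree L + degree s"
      using r by (simp add: degree_mult_eq)
    then obtain q where q: "degree q \<le> degree s"
        "\<And>w. w \<noteq> 0 \<Longrightarrow> cpoly s (w + 1 / w) = cpoly q w * cpoly q (1 / w)"
      using less.hyps[of s] s r(3) by auto
    have "degree (l * q) \<le> degree r"
      using degree_mult_le[of l q] deg L(1) q(1) by simp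
    moreover have "cpoly r (w + 1 / w) = cpoly (l * q) w * cpoly (l * q) (1 / w)" if "w \<noteq> 0" for w
      using L(2)[OF that] q(2)[OF that] by (simp add: r(1) mult_ac)
    ultimately show ?thesis
      by blast
  qed
  show ?case
  proof (cases "degree r = 0")
    case True
    then obtain c where c: "r = [:c:]"
      by (meson degree_eq_zeroE)
    then have "c > 0"
      using less.prems[of 0] by simp
    then show ?thesis
      by (intro exI[of _ "[:sqrt c:]"]) (simp add: c flip: of_real_mult)
  next
    case False
    then obtain c where c: "cpoly r c = 0"
      using ex_cpoly_root by blast
    show ?thesis
    proof (cases "Im c = 0")
      case True
      define x where "x = Re c"
      have "c = of_real x"
        using True by (simp add: x_def complex_eq_iff)
      then have root: "poly r x = 0"
        using c by (simp add: cpoly_of_real)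
      then have x: "\<bar>x\<bar> > 2"
        using less.prems[of x] by force
      then have "x \<noteq> 0"
        by auto
      obtain b where b: "b \<noteq> 0" "b + 1 / b = x"
        by (rule ex_real_joukowski_preimage[OF x])
      \<comment> \<open>The sign makes L positive on \<open>[-2, 2]\<close>, as the cofactor has to
        remain positive there.\<close>
      define L where "L = smult (sgn x) [:x, -1:]"
      \<comment> \<open>The scaling enters squared as \<open>1 / \<bar>b\<bar>\<close> and meets a
        factor b; their product is \<open>sgn x\<close>, since
        \<open>b * x = b\<^sup>2 + 1 > 0\<close>.\<close>
      define l where "l = smult (1 / sqrt \<bar>b\<bar>) [:1, - b:]"
      have posL: "poly L y > 0" if "\<bar>y\<bar> \<le> 2" for y
        using that x by (auto simp: L_def sgn_if abs_if split: if_splits)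
      have "[:- x, 1:] dvd r"
        using root by (simp add: poly_eq_0_iff_dvd)
      moreover have "[:- x, 1:] = smult (- sgn x) L"
        using \<open>x \<noteq> 0\<close> by (simp add: L_def sgn_if)
      ultimately have "smult (- sgn x) L dvd r"
        by (simp only:)
      then have "L dvd r"
        by (rule smult_dvd_cancel)
      then obtain s where r: "r = L * s" ..
      have sgn_b: "sgn x * \<bar>b\<bar> = b"
      proof -
        have "b * x = b\<^sup>2 + 1"
          unfolding b(2)[symmetric] using b(1) by (simp add: power2_eq_square distrib_left)
        then have "b * x > 0"
          by (simp add: add_nonneg_pos)
        then show ?thesis
          by (auto simp: zero_less_mult_iff sgn_if)
      qed
      show ?thesis
      proof (rule step[OF r])
        show "L \<noteq> 0" "degree L > 0"
          using \<open>x \<noteq> 0\<close> by (auto simp: L_def sgn_if)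
        show "degree l \<le> degree L"
          using \<open>x \<noteq> 0\<close> b(1) by (auto simp: L_def l_def sgn_if)
        show "poly s y > 0" if "\<bar>y\<bar> \<le> 2" for y
          using less.prems[OF that] posL[OF that] by (simp add: r zero_less_mult_iff)
        show "cpoly L (w + 1 / w) = cpoly l w * cpoly l (1 / w)" if "w \<noteq> 0" for w
        proof -
          define k where "k = 1 / sqrt \<bar>b\<bar>"
          have cl: "cpoly l y = of_real k * (1 - b * y)" for y :: complex
            unfolding l_def k_def[symmetric] by (simp add: algebra_simps)
          have "cpoly l w * cpoly l (1 / w) = of_real (k * k) * ((1 - b * w) * (1 - b * (1 / w)))"
            by (simp only: cl of_real_mult mult_ac)
          also have "k * k = 1 / \<bar>b\<bar>"
            by (simp add: k_def)
          also have "(1 - b * w) * (1 - b * (1 / w)) = b * (x - (w + 1 / w))"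
            using that b(1) unfolding b(2)[symmetric] by (simp add: field_simps)
          also have "of_real (1 / \<bar>b\<bar>) * (b * (x - (w + 1 / w))) = of_real (b / \<bar>b\<bar>) * (x - (w + 1 / w))"
            by simp
          also have "b / \<bar>b\<bar> = sgn x"
            using sgn_b b(1) by (simp add: field_simps)
          finally show ?thesis
            by (simp add: L_def algebra_simps)
        qed
      qed
    next
      case False
      obtain b where b: "b \<noteq> 0" "b + 1 / b = c"
        by (rule ex_joukowski_preimage)
      define L where "L = [:(cmod c)\<^sup>2, - 2 * Re c, 1:]"
      define k where "k = 1 / cmod b"
      \<comment> \<open>The square of k cancels the product of the factors b and
        \<open>cnj b\<close> that the two conjugate roots produce.\<close>
      define l where "l = smult k [:1, - 2 * Re b, (cmod b)\<^sup>2:]"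
      have cL: "cpoly L y = (c - y) * (cnj c - y)" for y
      proof -
        have "cpoly L y = complex_of_real ((cmod c)\<^sup>2) - complex_of_real (2 * Re c) * y + y * y"
          by (simp add: L_def algebra_simps)
        then show ?thesis
          by (simp only: complex_norm_square complex_add_cnj[symmetric]) (simp add: algebra_simps)
      qed
      have cl: "cpoly l w = k * ((1 - b * w) * (1 - cnj b * w))" for w
      proof -
        have "cpoly l w = k * (1 - complex_of_real (2 * Re b) * w + complex_of_real ((cmod b)\<^sup>2) * w * w)"
          by (simp add: l_def algebra_simps)
        then show ?thesis
          by (simp only: complex_norm_square complex_add_cnj[symmetric]) (simp add: algebra_simps)
      qed
      have posL: "poly L y > 0" for y
      proof -
        have "poly L y = (y - Re c)\<^sup>2 + (Im c)\<^sup>2"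
          unfolding L_def cmod_power2 by (simp add: power2_eq_square algebra_simps)
        then show ?thesis
          using False by (simp add: add_nonneg_pos)
      qed
      obtain s where r: "r = L * s"
        using dvd_of_nonreal_root[OF c False] by (auto simp: L_def)
      show ?thesis
      proof (rule step[OF r])
        show "L \<noteq> 0" "degree L > 0"
          by (simp_all add: L_def)
        show "degree l \<le> degree L"
          by (simp add: L_def l_def degree_smult_eq)
        show "poly s y > 0" if "\<bar>y\<bar> \<le> 2" for y
          using less.prems[OF that] posL[of y] by (simp add: r zero_less_mult_iff)
        show "cpoly L (w + 1 / w) = cpoly l w * cpoly l (1 / w)" if w: "w \<noteq> 0" for w
        proof -
          have factor: "(1 - a * w) * (1 - a * (1 / w)) = a * (a + 1 / a - (w + 1 / w))"
            if "a \<noteq> 0" for a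
            using that w by (simp add: field_simps)
          have cnj_b: "cnj b \<noteq> 0" "cnj b + 1 / cnj b = cnj c"
            using b(1) arg_cong[OF b(2), of cnj] by simp_all
          have "cpoly l w * cpoly l (1 / w) = of_real (k * k) *
              (((1 - b * w) * (1 - b * (1 / w))) * ((1 - cnj b * w) * (1 - cnj b * (1 / w))))"
            by (simp only: cl of_real_mult mult_ac)
          also have "\<dots> = of_real (k * k) * ((b * (c - (w + 1 / w))) * (cnj b * (cnj c - (w + 1 / w))))"
            by (simp only: factor[OF b(1)] factor[OF cnj_b(1)] b(2) cnj_b(2))
          also have "\<dots> = of_real (k\<^sup>2 * (cmod b)\<^sup>2) * cpoly L (w + 1 / w)"
            unfolding cL of_real_mult complex_norm_square by (simp only: power2_eq_square of_real_mult mult_ac)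
          also have "k\<^sup>2 * (cmod b)\<^sup>2 = 1"
            using b(1) by (simp add: k_def power_divide)
          finally show ?thesis
            by simp
        qed
      qed
    qed
  qed
qed

text \<open>At y these are \<open>2 * T_n(y / 2)\<close> with \<open>T_n\<close> the Chebyshev
  polynomials of the first kind.\<close>

fun power_sum_poly :: "nat \<Rightarrow> real poly" where
  "power_sum_poly 0 = [:2:]"
| "power_sum_poly (Suc 0) = [:0, 1:]"
| "power_sum_poly (Suc (Suc n)) = pCons 0 (power_sum_poly (Suc n)) - power_sum_poly n"

lemma cpoly_power_sum_poly:
  "w \<noteq> 0 \<Longrightarrow> cpoly (power_sum_poly n) (w + 1 / w) = w ^ n + 1 / w ^ n"
  by (induction n rule: power_sum_poly.induct) (simp_all add: field_simps)

lemma degree_power_sum_poly: "degree (power_sum_poly n) \<le> n"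
proof (induction n rule: power_sum_poly.induct)
  case (3 n)
  have "degree (pCons 0 (power_sum_poly (Suc n))) \<le> Suc (Suc n)"
    using 3(1) by (simp add: degree_pCons_eq_if)
  then show ?case
    using 3(2) by (auto intro: degree_diff_le)
qed simp_all

section \<open>Laurent polynomials\<close>

lemma sum_laurent_exponents: "(\<Sum>n\<in>laurent_exponents d. h n) = (\<Sum>k\<le>d. h (2 * int k - int d))"
  unfolding laurent_exponents_def atLeast0AtMost by (subst sum.reindex) (auto simp: inj_on_def)

lemma laurent_eval_altdef:
  "laurent_eval d f z = (\<Sum>k\<le>d. of_real (f (2 * int k - int d)) * z powi (2 * int k - int d))"
  unfolding laurent_eval_def by (rule sum_laurent_exponents)

lemma laurent_eval_linear:
  "laurent_eval d (\<lambda>n. a * f n + b * g n) z = of_real a * laurent_eval d f z + of_real b * laurent_eval d g z"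
  by (simp add: laurent_eval_def sum.distrib sum_distrib_left algebra_simps)

text \<open>The exponents are symmetric about 0: passing from k to \<open>d - k\<close> negates
  them.\<close>

lemma laurent_eval_reflect: "laurent_eval d (\<lambda>n. f (- n)) z = laurent_eval d f (1 / z)"
proof -
  have "laurent_eval d (\<lambda>n. f (- n)) z
      = (\<Sum>k\<le>d. of_real (f (- (2 * int (d - k) - int d))) * z powi (2 * int (d - k) - int d))"
    unfolding laurent_eval_altdef by (rule sum.nat_diff_reindex[of _ "Suc d", symmetric, unfolded lessThan_Suc_atMost, simplified])
  also have "\<dots> = laurent_eval d f (1 / z)"
    unfolding laurent_eval_altdef
  proof (rule sum.cong[OF refl])
    fix k
    assume "k \<in> {..d}"
    then have "2 * int (d - k) - int d = - (2 * int k - int d)"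
      by (simp add: of_nat_diff)
    then show "of_real (f (- (2 * int (d - k) - int d))) * z powi (2 * int (d - k) - int d)
        = of_real (f (2 * int k - int d)) * (1 / z) powi (2 * int k - int d)"
      by (simp only: minus_minus power_int_minus power_int_one_over inverse_eq_divide)
  qed
  finally show ?thesis .
qed

text \<open>Multiplication by z carries the exponents of level d onto those of level
  \<open>Suc d\<close> except the lowest, whose coefficient is therefore set to 0.\<close>

lemma laurent_eval_Suc_shift_up:
  assumes "z \<noteq> 0"
  shows "laurent_eval (Suc d) (\<lambda>n. if n = - int (Suc d) then 0 else f (n - 1)) z = z * laurent_eval d f z"
proof -
  have "z powi (1 + m) = z * z powi m" for m
    using assms by (simp add: power_int_add)
  moreover have "2 * int (Suc k) - int (Suc d) = 1 + (2 * int k - int d)" for k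
    by simp
  ultimately show ?thesis
    unfolding laurent_eval_altdef
    by (subst sum.atMost_Suc_shift) (simp add: sum_distrib_left mult.left_commute)
qed

lemma laurent_eval_Suc_shift_down:
  assumes "z \<noteq> 0"
  shows "laurent_eval (Suc d) (\<lambda>n. if n = int (Suc d) then 0 else f (n + 1)) z = 1 / z * laurent_eval d f z"
proof -
  have "laurent_eval (Suc d) (\<lambda>n. if n = int (Suc d) then 0 else f (n + 1)) z
      = laurent_eval (Suc d) (\<lambda>n. if n = - int (Suc d) then 0 else f (- (n - 1))) (1 / z)"
    unfolding laurent_eval_reflect[symmetric]
    by (rule arg_cong[where f = "\<lambda>h. laurent_eval (Suc d) h z"]) (auto simp: fun_eq_iff algebra_simps)
  also have "\<dots> = 1 / z * laurent_eval d f z"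
    using assms laurent_eval_Suc_shift_up[of "1 / z" d "\<lambda>n. f (- n)"] by (simp add: laurent_eval_reflect)
  finally show ?thesis .
qed

text \<open>The upward shift read backwards: once the lowest coefficient vanishes, a factor z can be
  taken out and the level drops.\<close>

lemma laurent_eval_Suc_drop:
  assumes "z \<noteq> 0" "f (- int (Suc d)) = 0"
  shows "z * laurent_eval d (\<lambda>n. f (n + 1)) z = laurent_eval (Suc d) f z"
proof -
  have "(\<lambda>n. if n = - int (Suc d) then 0 else f (n - 1 + 1)) = f"
    using assms(2) by auto
  then show ?thesis
    using laurent_eval_Suc_shift_up[OF assms(1), of d "\<lambda>n. f (n + 1)"] by simp
qed

text \<open>Clearing the denominator leaves a polynomial in \<open>z\<^sup>2\<close>, because
  consecutive exponents differ by 2.\<close>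

lemma laurent_eval_power:
  assumes "z \<noteq> 0"
  shows "z ^ d * laurent_eval d f z = (\<Sum>k\<le>d. of_real (f (2 * int k - int d)) * z ^ (2 * k))"
proof -
  have "z ^ d * z powi (2 * int k - int d) = z ^ (2 * k)" for k
  proof -
    have "z powi (int d + (2 * int k - int d)) = z powi int d * z powi (2 * int k - int d)"
      using assms by (intro power_int_add) auto
    then show ?thesis
      by (simp flip: power_int_of_nat)
  qed
  then show ?thesis
    by (simp add: laurent_eval_altdef sum_distrib_left mult.left_commute[of "z ^ d"])
qed

lemma of_real_cos_sin:
  "complex_of_real (cos t) * complex_of_real (cos t) + complex_of_real (sin t) * complex_of_real (sin t) = 1"
proof -
  have "complex_of_real (cos t) * complex_of_real (cos t) + complex_of_real (sin t) * complex_of_real (sin t)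
      = complex_of_real ((cos t)\<^sup>2 + (sin t)\<^sup>2)"
    by (simp only: of_real_add of_real_mult power2_eq_square)
  then show ?thesis
    by simp
qed

section \<open>The scalar signal processing sequence\<close>

text \<open>The pair \<open>(F, G)\<close> stands for the matrix with rows
  \<open>(F(z), \<i> G(z))\<close> and \<open>(\<i> G(1/z), F(1/z))\<close>. A rotation mixes both
  rows, so each step evaluates the previous pair at z and at \<open>1 / z\<close>; hence the values
  are functions of z.\<close>

primrec qsp_pair :: "(nat \<Rightarrow> real) \<Rightarrow> nat \<Rightarrow> complex \<Rightarrow> complex \<times> complex" where
  "qsp_pair \<theta> 0 = (\<lambda>z. (of_real (cos (\<theta> 0)), of_real (sin (\<theta> 0))))"
| "qsp_pair \<theta> (Suc k) = (\<lambda>z.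
    (of_real (cos (\<theta> (Suc k))) * (z * fst (qsp_pair \<theta> k z)) - of_real (sin (\<theta> (Suc k))) * (1 / z * snd (qsp_pair \<theta> k (1 / z))),
     of_real (cos (\<theta> (Suc k))) * (z * snd (qsp_pair \<theta> k z)) + of_real (sin (\<theta> (Suc k))) * (1 / z * fst (qsp_pair \<theta> k (1 / z)))))"

definition qsp_F :: "(nat \<Rightarrow> real) \<Rightarrow> nat \<Rightarrow> complex \<Rightarrow> complex" where
  "qsp_F \<theta> k z = fst (qsp_pair \<theta> k z)"

definition qsp_G :: "(nat \<Rightarrow> real) \<Rightarrow> nat \<Rightarrow> complex \<Rightarrow> complex" where
  "qsp_G \<theta> k z = snd (qsp_pair \<theta> k z)"

lemma qsp_F_0: "qsp_F \<theta> 0 z = of_real (cos (\<theta> 0))"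
  and qsp_G_0: "qsp_G \<theta> 0 z = of_real (sin (\<theta> 0))"
  and qsp_F_Suc: "qsp_F \<theta> (Suc k) z
    = of_real (cos (\<theta> (Suc k))) * (z * qsp_F \<theta> k z) - of_real (sin (\<theta> (Suc k))) * (1 / z * qsp_G \<theta> k (1 / z))"
  and qsp_G_Suc: "qsp_G \<theta> (Suc k) z
    = of_real (cos (\<theta> (Suc k))) * (z * qsp_G \<theta> k z) + of_real (sin (\<theta> (Suc k))) * (1 / z * qsp_F \<theta> k (1 / z))"
  by (simp_all add: qsp_F_def qsp_G_def)

lemma qsp_pair_cong: "(\<And>j. j \<le> k \<Longrightarrow> \<theta> j = \<theta>' j) \<Longrightarrow> qsp_pair \<theta> k = qsp_pair \<theta>' k"
  by (induction k) simp_all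

lemma qsp_laurent:
  "\<exists>f g. \<forall>z. z \<noteq> 0 \<longrightarrow> qsp_F \<theta> k z = laurent_eval k f z \<and> qsp_G \<theta> k z = laurent_eval k g z"
proof (induction k)
  case 0
  show ?case
    by (intro exI[of _ "\<lambda>_. cos (\<theta> 0)"] exI[of _ "\<lambda>_. sin (\<theta> 0)"])
      (simp add: qsp_F_0 qsp_G_0 laurent_eval_altdef)
next
  case (Suc k)
  then obtain f g where fg: "qsp_F \<theta> k z = laurent_eval k f z" "qsp_G \<theta> k z = laurent_eval k g z"
    if "z \<noteq> 0" for z
    by blast
  define up where "up = (\<lambda>(h :: int \<Rightarrow> real) n. if n = - int (Suc k) then 0 else h (n - 1))"
  \<comment> \<open>Reflection followed by a downward shift: the coefficients of
    \<open>1 / z\<close> times h evaluated at \<open>1 / z\<close>.\<close>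
  define down where "down = (\<lambda>(h :: int \<Rightarrow> real) n. if n = int (Suc k) then 0 else h (- (n + 1)))"
  have up: "laurent_eval (Suc k) (up h) z = z * laurent_eval k h z" if "z \<noteq> 0" for h z
    unfolding up_def by (rule laurent_eval_Suc_shift_up[OF that])
  have down: "laurent_eval (Suc k) (down h) z = 1 / z * laurent_eval k h (1 / z)" if "z \<noteq> 0" for h z
    using laurent_eval_Suc_shift_down[OF that, of k "\<lambda>n. h (- n)"]
    by (simp only: down_def laurent_eval_reflect)
  let ?c = "cos (\<theta> (Suc k))" and ?s = "sin (\<theta> (Suc k))"
  have "qsp_F \<theta> (Suc k) z = laurent_eval (Suc k) (\<lambda>n. ?c * up f n + (- ?s) * down g n) z
      \<and> qsp_G \<theta> (Suc k) z = laurent_eval (Suc k) (\<lambda>n. ?c * up g n + ?s * down f n) z"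
    if "z \<noteq> 0" for z
    unfolding laurent_eval_linear up[OF that] down[OF that]
    using that by (simp add: qsp_F_Suc qsp_G_Suc fg)
  then show ?case
    by blast
qed

text \<open>The left side is the determinant of the matrix encoded by \<open>qsp_pair\<close>, and
  every rotation and every signal factor has determinant 1.\<close>

lemma qsp_unit_norm:
  assumes "z \<noteq> 0"
  shows "qsp_F \<theta> k z * qsp_F \<theta> k (1 / z) + qsp_G \<theta> k z * qsp_G \<theta> k (1 / z) = 1"
  using assms
proof (induction k arbitrary: z)
  case 0
  show ?case
    by (simp only: qsp_F_0 qsp_G_0 of_real_cos_sin)
next
  case (Suc k)
  define c s where "c = complex_of_real (cos (\<theta> (Suc k)))" and "s = complex_of_real (sin (\<theta> (Suc k)))"
  define v where "v = 1 / z"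
  have v: "z * v = 1" "1 / v = z"
    using Suc.prems by (simp_all add: v_def)
  have "c * c + s * s = 1"
    unfolding c_def s_def by (rule of_real_cos_sin)
  moreover have "(c * (z * F) - s * (v * G')) * (c * (v * F') - s * (z * G))
      + (c * (z * G) + s * (v * F')) * (c * (v * G') + s * (z * F))
      = (c * c + s * s) * ((z * v) * (F * F' + G * G'))" for F F' G G'
    by (simp add: algebra_simps)
  ultimately show ?case
    using Suc.IH[OF Suc.prems]
    unfolding qsp_F_Suc qsp_G_Suc c_def[symmetric] s_def[symmetric] v_def[symmetric] v(2)
    by (simp only: v(1) mult_1)
qed

section \<open>Angles of a normalized pair of Laurent polynomials\<close>

text \<open>This is the coefficient of \<open>z ^ (- 2 d)\<close> in the hypothesis. Clearing
  denominators gives a polynomial that vanishes off the origin, hence by continuity also at 0, where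
  \<open>z ^ (2 * d)\<close> vanishes because \<open>d > 0\<close>.\<close>

lemma laurent_extreme_coefficients:
  assumes d: "d > 0"
    and norm: "\<And>z. z \<noteq> 0 \<Longrightarrow> laurent_eval d f z * laurent_eval d f (1 / z)
      + laurent_eval d g z * laurent_eval d g (1 / z) = 1"
  shows "f (int d) * f (- int d) + g (int d) * g (- int d) = 0"
proof -
  define A where "A h z = (\<Sum>k\<le>d. complex_of_real (h (2 * int k - int d)) * z ^ (2 * k))" for h z
  define \<phi> where "\<phi> z = A f z * A (\<lambda>n. f (- n)) z + A g z * A (\<lambda>n. g (- n)) z - z ^ (2 * d)" for z
  have A: "A h z = z ^ d * laurent_eval d h z" if "z \<noteq> 0" for h z
    using laurent_eval_power[OF that] by (simp add: A_def)
  have "\<phi> z = z ^ d * z ^ d * (laurent_eval d f z * laurent_eval d f (1 / z)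
      + laurent_eval d g z * laurent_eval d g (1 / z)) - z ^ (2 * d)" if "z \<noteq> 0" for z
    using that by (simp add: \<phi>_def A laurent_eval_reflect algebra_simps)
  then have "\<phi> z = 0" if "z \<noteq> 0" for z
    using norm[OF that] that by (simp add: power_mult power2_eq_square power_mult_distrib mult_2 power_add)
  then have "\<phi> \<midarrow>0\<rightarrow> 0"
    by (intro Lim_transform_eventually[OF tendsto_const]) (simp add: eventually_at_filter)
  moreover have "\<phi> \<midarrow>0\<rightarrow> \<phi> 0"
  proof -
    have "isCont \<phi> 0"
      unfolding \<phi>_def A_def by (intro continuous_intros)
    then show ?thesis
      by (simp add: isCont_def)
  qed
  ultimately have "\<phi> 0 = 0"
    by (rule LIM_unique[symmetric])
  moreover have "A h 0 = of_real (h (- int d))" for h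
  proof -
    have "A h 0 = (\<Sum>k\<le>d. if k = 0 then complex_of_real (h (- int d)) else 0)"
      unfolding A_def by (rule sum.cong) auto
    then show ?thesis
      by simp
  qed
  ultimately have "complex_of_real (f (- int d) * f (int d) + g (- int d) * g (int d)) = 0"
    using d by (simp add: \<phi>_def)
  then show ?thesis
    by (simp only: of_real_eq_0_iff) (simp add: mult.commute)
qed

lemma ex_angle_of_direction:
  fixes x y :: real
  assumes "x \<noteq> 0 \<or> y \<noteq> 0"
  obtains t \<rho> where "cos t = \<rho> * x" "sin t = \<rho> * y"
proof -
  define n where "n = sqrt (x\<^sup>2 + y\<^sup>2)"
  have "x\<^sup>2 + y\<^sup>2 > 0"
    using assms by (simp add: sum_power2_gt_zero_iff)
  then have "(x / n)\<^sup>2 + (y / n)\<^sup>2 = 1"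
    using assms by (simp add: n_def power_divide flip: add_divide_distrib)
  then obtain t where "x / n = cos t" "y / n = sin t"
    using sincos_total_2pi by metis
  then show ?thesis
    using that[of t "1 / n"] by simp
qed

text \<open>Two homogeneous equations for the direction \<open>(cos t, sin t)\<close>; up to sign,
  \<open>det\<close> is their determinant, so any direction orthogonal to a nonzero row solves
  both.\<close>

lemma ex_annihilating_angle:
  fixes a b a' b' :: real
  assumes det: "a' * a + b * b' = 0"
  obtains t where "cos t * a + sin t * b = 0" "cos t * b' - sin t * a' = 0"
proof (cases "a = 0 \<and> b = 0")
  case True
  show ?thesis
  proof (cases "a' = 0 \<and> b' = 0")
    case True
    with \<open>a = 0 \<and> b = 0\<close> show ?thesis
      using that[of 0] by simp
  next
    case False
    then obtain t \<rho> where "cos t = \<rho> * a'" "sin t = \<rho> * b'"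
      using ex_angle_of_direction[of a' b'] by blast
    then show ?thesis
      using that[of t] \<open>a = 0 \<and> b = 0\<close> by simp
  qed
next
  case False
  then obtain t \<rho> where t: "cos t = \<rho> * b" "sin t = \<rho> * (- a)"
    using ex_angle_of_direction[of b "- a"] by auto
  moreover have "\<rho> * b * b' - \<rho> * (- a) * a' = \<rho> * (a' * a + b * b')"
    by (simp add: algebra_simps)
  ultimately show ?thesis
    using that[of t] det by simp
qed

lemma ex_qsp_angles:
  assumes "\<And>z. z \<noteq> 0 \<Longrightarrow> laurent_eval d f z * laurent_eval d f (1 / z)
      + laurent_eval d g z * laurent_eval d g (1 / z) = 1"
  shows "\<exists>\<theta>. \<forall>z. z \<noteq> 0 \<longrightarrow> qsp_F \<theta> d z = laurent_eval d f z \<and> qsp_G \<theta> d z = laurent_eval d g z"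
  using assms
proof (induction d arbitrary: f g)
  case 0
  have "complex_of_real ((f 0)\<^sup>2 + (g 0)\<^sup>2) = 1"
    using 0[of 1] by (simp add: laurent_eval_altdef power2_eq_square)
  then have "(f 0)\<^sup>2 + (g 0)\<^sup>2 = 1"
    by (simp only: of_real_eq_1_iff)
  then obtain t where "f 0 = cos t" "g 0 = sin t"
    using sincos_total_2pi by metis
  then show ?case
    by (intro exI[of _ "\<lambda>_. t"]) (simp add: qsp_F_0 qsp_G_0 laurent_eval_altdef)
next
  case (Suc d)
  have "f (int (Suc d)) * f (- int (Suc d)) + g (int (Suc d)) * g (- int (Suc d)) = 0"
    by (rule laurent_extreme_coefficients) (use Suc.prems in auto)
  \<comment> \<open>A single angle has to remove the lowest coefficients of both \<open>f'\<close>
    and \<open>g'\<close>; orthogonality of the extreme coefficients makes the two conditions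
    compatible.\<close>
  then obtain t where t: "cos t * f (- int (Suc d)) + sin t * g (int (Suc d)) = 0"
      "cos t * g (- int (Suc d)) - sin t * f (int (Suc d)) = 0"
    by (rule ex_annihilating_angle)
  \<comment> \<open>First row after multiplication by the rotation through \<open>- t\<close>; the
    reflected coefficients come from the second row.\<close>
  define f' where "f' n = cos t * f n + sin t * g (- n)" for n
  define g' where "g' n = cos t * g n + (- sin t) * f (- n)" for n
  let ?F = "laurent_eval (Suc d) f" and ?G = "laurent_eval (Suc d) g"
  \<comment> \<open>The index shift divides by z, which removes the signal factor from the first
    row.\<close>
  let ?F' = "laurent_eval d (\<lambda>n. f' (n + 1))" and ?G' = "laurent_eval d (\<lambda>n. g' (n + 1))"
  define c s where "c = complex_of_real (cos t)" and "s = complex_of_real (sin t)"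
  have cs: "c * c + s * s = 1"
    unfolding c_def s_def by (rule of_real_cos_sin)
  have F': "z * ?F' z = c * ?F z + s * ?G (1 / z)" if "z \<noteq> 0" for z
  proof -
    have "z * ?F' z = laurent_eval (Suc d) f' z"
      by (intro laurent_eval_Suc_drop that) (simp only: f'_def minus_minus t)
    also have "\<dots> = c * ?F z + s * ?G (1 / z)"
      unfolding f'_def laurent_eval_linear laurent_eval_reflect c_def s_def ..
    finally show ?thesis .
  qed
  have G': "z * ?G' z = c * ?G z - s * ?F (1 / z)" if "z \<noteq> 0" for z
  proof -
    have "z * ?G' z = laurent_eval (Suc d) g' z"
      by (intro laurent_eval_Suc_drop that)
        (use t(2) in \<open>simp only: g'_def minus_minus mult_minus_left diff_conv_add_uminus\<close>)
    also have "\<dots> = c * ?G z - s * ?F (1 / z)"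
      unfolding g'_def laurent_eval_linear laurent_eval_reflect c_def s_def by simp
    finally show ?thesis .
  qed
  have inv: "1 / z * ?F' (1 / z) = c * ?F (1 / z) + s * ?G z"
    "1 / z * ?G' (1 / z) = c * ?G (1 / z) - s * ?F z" if "z \<noteq> 0" for z
    using F'[of "1 / z"] G'[of "1 / z"] that by simp_all
  have "?F' z * ?F' (1 / z) + ?G' z * ?G' (1 / z) = 1" if z: "z \<noteq> 0" for z
  proof -
    have "?F' z * ?F' (1 / z) + ?G' z * ?G' (1 / z)
        = (z * ?F' z) * (1 / z * ?F' (1 / z)) + (z * ?G' z) * (1 / z * ?G' (1 / z))"
      using z by simp
    also have "\<dots> = (c * c + s * s) * (?F z * ?F (1 / z) + ?G z * ?G (1 / z))"
      unfolding F'[OF z] G'[OF z] inv[OF z] by (simp add: algebra_simps)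
    finally show ?thesis
      using Suc.prems[OF z] cs by simp
  qed
  then obtain \<theta> where \<theta>: "qsp_F \<theta> d z = ?F' z" "qsp_G \<theta> d z = ?G' z" if "z \<noteq> 0" for z
    using Suc.IH[of "\<lambda>n. f' (n + 1)" "\<lambda>n. g' (n + 1)"] by blast
  define \<theta>' where "\<theta>' = \<theta>(Suc d := t)"
  have "qsp_pair \<theta>' d = qsp_pair \<theta> d"
    by (rule qsp_pair_cong) (simp add: \<theta>'_def)
  then have \<theta>': "qsp_F \<theta>' d z = ?F' z" "qsp_G \<theta>' d z = ?G' z" if "z \<noteq> 0" for z
    using \<theta>[OF that] by (simp_all add: qsp_F_def qsp_G_def)
  have "qsp_F \<theta>' (Suc d) z = ?F z \<and> qsp_G \<theta>' (Suc d) z = ?G z" if z: "z \<noteq> 0" for z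
  proof
    have "qsp_F \<theta>' (Suc d) z = c * (z * ?F' z) - s * (1 / z * ?G' (1 / z))"
      using z by (simp add: qsp_F_Suc \<theta>' c_def s_def) (simp add: \<theta>'_def)
    also have "\<dots> = (c * c + s * s) * ?F z"
      unfolding F'[OF z] inv[OF z] by (simp add: algebra_simps)
    finally show "qsp_F \<theta>' (Suc d) z = ?F z"
      using cs by simp
    have "qsp_G \<theta>' (Suc d) z = c * (z * ?G' z) + s * (1 / z * ?F' (1 / z))"
      using z by (simp add: qsp_G_Suc \<theta>' c_def s_def) (simp add: \<theta>'_def)
    also have "\<dots> = (c * c + s * s) * ?G z"
      unfolding G'[OF z] inv[OF z] by (simp add: algebra_simps)
    finally show "qsp_G \<theta>' (Suc d) z = ?G z"
      using cs by simp
  qed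
  then show ?case
    by blast
qed

section \<open>The complementary Laurent polynomial\<close>

text \<open>In the product of F at z and at \<open>1 / z\<close>, the index pairs
  \<open>(k, l)\<close> and \<open>(l, k)\<close> carry the same coefficient and inverse powers of
  z, so they combine into power sums in \<open>z\<^sup>2\<close>.\<close>

lemma ex_complementary_laurent:
  assumes less: "\<And>z. cmod z = 1 \<Longrightarrow> laurent_eval d f z * laurent_eval d f (1 / z) < 1"
  obtains g where "\<And>z. z \<noteq> 0 \<Longrightarrow> laurent_eval d f z * laurent_eval d f (1 / z)
    + laurent_eval d g z * laurent_eval d g (1 / z) = 1"
proof -
  define c where "c k = f (2 * int k - int d)" for k
  \<comment> \<open>With truncated subtraction one summand is 0, so this is the absolute
    difference.\<close>
  define dist' where "dist' k l = (k - l) + (l - k)" for k l :: nat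
  \<comment> \<open>The factor \<open>1 / 2\<close> compensates for symmetrizing the double sum in k
    and l.\<close>
  define r :: "real poly" where
    "r = 1 - smult (1 / 2) (\<Sum>k\<le>d. \<Sum>l\<le>d. smult (c k * c l) (power_sum_poly (dist' k l)))"
  have "degree (\<Sum>k\<le>d. \<Sum>l\<le>d. smult (c k * c l) (power_sum_poly (dist' k l))) \<le> d"
    by (intro degree_sum_le finite_atMost order.trans[OF degree_smult_le]
        order.trans[OF degree_power_sum_poly]) (auto simp: dist'_def)
  then have deg_r: "degree r \<le> d"
    unfolding r_def by (intro degree_diff_le order.trans[OF degree_smult_le]) simp_all
  have r: "cpoly r (z\<^sup>2 + 1 / z\<^sup>2) = 1 - laurent_eval d f z * laurent_eval d f (1 / z)"
    if z: "z \<noteq> 0" for z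
  proof -
    let ?m = "\<lambda>k l. z powi (2 * (int k - int l))"
    have "cpoly (power_sum_poly (dist' k l)) (z\<^sup>2 + 1 / z\<^sup>2) = ?m k l + ?m l k" for k l
    proof (cases "k \<le> l")
      case True
      have "?m l k = z powi int (2 * dist' k l)" "?m k l = z powi (- int (2 * dist' k l))"
        using True by (simp_all add: dist'_def of_nat_diff algebra_simps)
      then show ?thesis
        unfolding cpoly_power_sum_poly[OF power_not_zero[OF z]] power_int_minus power_int_of_nat
        by (simp add: power_mult divide_inverse)
    next
      case False
      have "?m k l = z powi int (2 * dist' k l)" "?m l k = z powi (- int (2 * dist' k l))"
        using False by (simp_all add: dist'_def of_nat_diff algebra_simps)
      then show ?thesis
        unfolding cpoly_power_sum_poly[OF power_not_zero[OF z]] power_int_minus power_int_of_nat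
        by (simp add: power_mult divide_inverse)
    qed
    then have "cpoly r (z\<^sup>2 + 1 / z\<^sup>2)
        = 1 - 1 / 2 * ((\<Sum>k\<le>d. \<Sum>l\<le>d. c k * c l * ?m k l) + (\<Sum>k\<le>d. \<Sum>l\<le>d. c k * c l * ?m l k))"
      by (simp add: r_def cpoly_sum one_pCons distrib_left sum.distrib)
    also have "(\<Sum>k\<le>d. \<Sum>l\<le>d. c k * c l * ?m l k) = (\<Sum>k\<le>d. \<Sum>l\<le>d. c k * c l * ?m k l)"
      by (subst sum.swap) (simp only: mult_ac)
    also have "(\<Sum>k\<le>d. \<Sum>l\<le>d. c k * c l * ?m k l) = laurent_eval d f z * laurent_eval d f (1 / z)"
    proof -
      have *: "c k * c l * ?m k l = c k * z powi (2 * int k - int d) * (c l * (1 / z) powi (2 * int l - int d))"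
        for k l
      proof -
        have "?m k l = z powi ((2 * int k - int d) - (2 * int l - int d))"
          by (simp add: algebra_simps)
        also have "\<dots> = z powi (2 * int k - int d) * (1 / z) powi (2 * int l - int d)"
          using z by (simp add: power_int_diff power_int_one_over)
        finally show ?thesis
          by (simp add: mult_ac)
      qed
      show ?thesis
        unfolding laurent_eval_altdef sum_product c_def[symmetric] by (simp only: *)
    qed
    finally show ?thesis
      by simp
  qed
  have "poly r y > 0" if y: "\<bar>y\<bar> \<le> 2" for y
  proof -
    \<comment> \<open>Writing \<open>y = 2 * cos t\<close> and taking z as a square root of
      \<open>cis t\<close> gives \<open>z\<^sup>2 + 1 / z\<^sup>2 = y\<close>, so every y in the
      interval is reached from the unit circle.\<close>
    define t where "t = arccos (y / 2)"
    define z where "z = cis (t / 2)"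
    have "cos t = y / 2"
      unfolding t_def using y by (intro cos_arccos) auto
    then have "cis t + cis (- t) = of_real y"
      by (simp add: complex_eq_iff)
    moreover have "z\<^sup>2 = cis t"
      by (simp add: z_def power2_eq_square cis_mult)
    moreover have "1 / cis t = cis (- t)"
      by (simp add: divide_inverse)
    ultimately have y_z: "z\<^sup>2 + 1 / z\<^sup>2 = of_real y"
      by (simp only:)
    have "complex_of_real (poly r y) = 1 - laurent_eval d f z * laurent_eval d f (1 / z)"
      unfolding cpoly_of_real[symmetric] y_z[symmetric] by (rule r) (simp add: z_def)
    moreover have "laurent_eval d f z * laurent_eval d f (1 / z) < 1"
      by (rule less) (simp add: z_def)
    ultimately have "complex_of_real (poly r y) > 0"
      by simp
    then show ?thesis
      by (simp add: less_complex_def)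
  qed
  then obtain q where deg_q: "degree q \<le> degree r"
    and q: "\<And>w. w \<noteq> 0 \<Longrightarrow> cpoly r (w + 1 / w) = cpoly q w * cpoly q (1 / w)"
    using fejer_riesz by blast
  \<comment> \<open>Inverts \<open>k \<mapsto> 2 * k - d\<close>, so that
    \<open>z ^ d * laurent_eval d g z\<close> is q at \<open>z\<^sup>2\<close>.\<close>
  define g where "g n = coeff q (nat ((n + int d) div 2))" for n
  have g: "z ^ d * laurent_eval d g z = cpoly q (z\<^sup>2)" if "z \<noteq> 0" for z
    unfolding laurent_eval_power[OF that] cpoly_altdef[OF order.trans[OF deg_q deg_r]]
    by (simp add: g_def power_mult)
  show ?thesis
  proof (rule that)
    fix z :: complex
    assume z: "z \<noteq> 0"
    have "laurent_eval d g z * laurent_eval d g (1 / z)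
        = (z ^ d * laurent_eval d g z) * ((1 / z) ^ d * laurent_eval d g (1 / z))"
      using z by (simp add: power_divide)
    also have "\<dots> = cpoly q (z\<^sup>2) * cpoly q (1 / z\<^sup>2)"
      using g[of z] g[of "1 / z"] z by (simp add: power_divide)
    also have "\<dots> = 1 - laurent_eval d f z * laurent_eval d f (1 / z)"
      using q[of "z\<^sup>2"] r[OF z] z by simp
    finally show "laurent_eval d f z * laurent_eval d f (1 / z)
        + laurent_eval d g z * laurent_eval d g (1 / z) = 1"
      by simp
  qed
qed

section \<open>The signal processing operator\<close>

lemma x_rotation_eq:
  "x_rotation \<theta> = block (scaleC (of_real (cos \<theta>))) (scaleC (\<i> * of_real (sin \<theta>)))
    (scaleC (\<i> * of_real (sin \<theta>))) (scaleC (of_real (cos \<theta>)))"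
proof -
  define c where "c = \<i> * complex_of_real \<theta>"
  define M where "M = map_matrix ((*) c) pauli_x"
  \<comment> \<open>The matrix with eigenvalue a on \<open>(1, 1)\<close> and b on
    \<open>(1, -1)\<close>, the eigenvectors of \<open>pauli_x\<close>. Powers and exponentials of M
    act on the two eigenvalues separately.\<close>
  define N where "N a b = (\<chi> i j. if i = j then (a + b) / 2 else (a - b) / 2 :: complex^2^2)" for a b :: complex
  have M: "M $ 1 $ 1 = 0" "M $ 1 $ 2 = c" "M $ 2 $ 1 = c" "M $ 2 $ 2 = 0"
    by (simp_all add: M_def map_matrix_def pauli_x_def vector_2)
  have "((**) M ^^ k) (mat 1) = N (c ^ k) ((- c) ^ k)" for k
  proof (induction k)
    case 0
    show ?case
      by (simp add: N_def mat_def vec_eq_iff)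
  next
    case (Suc k)
    have "M ** N a b = N (c * a) (- c * b)" for a b
      by (simp add: vec_eq_iff forall_2 matrix_matrix_mult_def sum_2 M N_def algebra_simps)
    then show ?case
      using Suc by simp
  qed
  moreover have "(\<lambda>k. N (c ^ k) ((- c) ^ k) /\<^sub>R fact k) sums N (exp c) (exp (- c))"
    unfolding sums_def
  proof (intro vec_tendstoI)
    fix i j :: 2
    have eq: "((c ^ k + (- c) ^ k) / 2) /\<^sub>R fact k = ((c ^ k /\<^sub>R fact k) + (- c) ^ k /\<^sub>R fact k) / 2"
      "((c ^ k - (- c) ^ k) / 2) /\<^sub>R fact k = ((c ^ k /\<^sub>R fact k) - (- c) ^ k /\<^sub>R fact k) / 2" for k
      by (simp_all add: scaleR_conv_of_real algebra_simps)
    have "(\<lambda>k. ((c ^ k + (- c) ^ k) / 2) /\<^sub>R fact k) sums ((exp c + exp (- c)) / 2)"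
      "(\<lambda>k. ((c ^ k - (- c) ^ k) / 2) /\<^sub>R fact k) sums ((exp c - exp (- c)) / 2)"
      unfolding eq by (intro sums_divide sums_add sums_diff exp_converges)+
    then show "(\<lambda>n. (\<Sum>k<n. N (c ^ k) ((- c) ^ k) /\<^sub>R fact k) $ i $ j) \<longlonglongrightarrow> N (exp c) (exp (- c)) $ i $ j"
      by (simp add: N_def sums_def)
  qed
  ultimately have "matrix_exp M = N (exp c) (exp (- c))"
    by (simp add: matrix_exp_def sums_iff)
  moreover have "exp c + exp (- c) = 2 * of_real (cos \<theta>)" "exp c - exp (- c) = 2 * (\<i> * of_real (sin \<theta>))"
    using cis_conv_exp[of \<theta>] cis_conv_exp[of "- \<theta>"] by (simp_all add: c_def complex_eq_iff)
  ultimately show ?thesis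
    by (simp add: x_rotation_def qubit_gate_def N_def flip: c_def M_def)
qed

context complete_pvm
begin

lemma borel_op_lincomb:
  assumes "bounded_borel e" "bounded_borel f" "bounded_borel e'" "bounded_borel f'"
  shows "borel_op (\<lambda>t. a * (e t * f t) + b * (e' t * f' t)) \<psi>
    = a *\<^sub>C borel_op e (borel_op f \<psi>) + b *\<^sub>C borel_op e' (borel_op f' \<psi>)"
  using assms
  by (simp add: borel_op_add borel_op_scale borel_op_mult bounded_borel_scale bounded_borel_mult)

lemma bounded_borel_unit_power_int:
  assumes "bounded_borel e" "\<And>t. cmod (e t) = 1"
  shows "bounded_borel (\<lambda>t. e t powi n)"
proof -
  have "e t powi n = (if n \<ge> 0 then e t ^ nat n else cnj (e t) ^ nat (- n))" for t
    by (simp only: power_int_def inverse_eq_cnj[OF assms(2)])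
  then show ?thesis
    using assms(1) by (cases "n \<ge> 0") (simp_all add: bounded_borel_power bounded_borel_cnj)
qed

lemma bounded_borel_laurent_eval:
  assumes "bounded_borel e" "\<And>t. cmod (e t) = 1"
  shows "bounded_borel (\<lambda>t. laurent_eval d f (e t))"
  unfolding laurent_eval_def
  by (intro bounded_borel_sum bounded_borel_scale bounded_borel_unit_power_int assms)

lemma laurent_op_borel_op:
  assumes "bounded_borel e" "\<And>t. cmod (e t) = 1"
  shows "laurent_op d f (borel_op e) = borel_op (\<lambda>t. laurent_eval d f (e t))"
proof
  fix \<psi>
  show "laurent_op d f (borel_op e) \<psi> = borel_op (\<lambda>t. laurent_eval d f (e t)) \<psi>"
    unfolding laurent_op_def laurent_eval_def op_powi_borel_op[OF assms]
    by (simp add: borel_op_sum borel_op_scale bounded_borel_scale bounded_borel_unit_power_int[OF assms])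
qed

lemma bounded_borel_qsp:
  assumes "bounded_borel e" "\<And>t. cmod (e t) = 1"
  shows "bounded_borel (\<lambda>t. qsp_F \<theta> k (e t))" "bounded_borel (\<lambda>t. qsp_G \<theta> k (e t))"
proof -
  obtain f g where "qsp_F \<theta> k z = laurent_eval k f z" "qsp_G \<theta> k z = laurent_eval k g z" if "z \<noteq> 0" for z
    using qsp_laurent[of \<theta> k] by blast
  moreover have "e t \<noteq> 0" for t
    using assms(2)[of t] by auto
  ultimately show "bounded_borel (\<lambda>t. qsp_F \<theta> k (e t))" "bounded_borel (\<lambda>t. qsp_G \<theta> k (e t))"
    using bounded_borel_laurent_eval[OF assms] by simp_all
qed

text \<open>Since \<open>borel_op\<close> is linear and multiplicative, the operator recursion
  mirrors \<open>qsp_pair\<close>, and the lower row is the upper one with e replaced by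
  \<open>1 / e\<close>.\<close>

lemma qsp_borel_op:
  assumes e: "bounded_borel e" "\<And>t. cmod (e t) = 1"
  shows "qsp (block (borel_op e) (\<lambda>\<psi>. 0) (\<lambda>\<psi>. 0) (borel_op (\<lambda>t. 1 / e t))) \<theta> k
    = block (borel_op (\<lambda>t. qsp_F \<theta> k (e t))) (\<lambda>\<psi>. \<i> *\<^sub>C borel_op (\<lambda>t. qsp_G \<theta> k (e t)) \<psi>)
        (\<lambda>\<psi>. \<i> *\<^sub>C borel_op (\<lambda>t. qsp_G \<theta> k (1 / e t)) \<psi>) (borel_op (\<lambda>t. qsp_F \<theta> k (1 / e t)))"
proof (induction k)
  case 0
  have "borel_op (\<lambda>t. a) \<psi> = a *\<^sub>C \<psi>" for a \<psi>
    using borel_op_scale[OF bounded_borel_const, of a 1 \<psi>] by (simp add: borel_op_one)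
  then show ?case
    by (simp add: x_rotation_eq block_def qsp_F_0 qsp_G_0 scaleC_scaleC fun_eq_iff)
next
  case (Suc k)
  define v where "v t = 1 / e t" for t
  have "v t = cnj (e t)" for t
    using inverse_eq_cnj[OF e(2)] by (simp add: v_def inverse_eq_divide)
  then have v: "bounded_borel v" "\<And>t. cmod (v t) = 1"
    using bounded_borel_cnj[OF e(1)] e(2) by (simp_all add: v_def[abs_def] norm_divide)
  have ev: "1 / e t = v t" "1 / v t = e t" for t
    by (simp_all add: v_def)
  define c s where "c = complex_of_real (cos (\<theta> (Suc k)))" and "s = complex_of_real (sin (\<theta> (Suc k)))"
  note bounded = e(1) v(1) bounded_borel_qsp[OF e] bounded_borel_qsp[OF v]
  note linear = clinear_borel_op[OF e(1)] clinear_borel_op[OF v(1)]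
  \<comment> \<open>The choice \<open>x = e\<close> serves the upper row of blocks and
    \<open>x = v\<close> the lower one.\<close>
  have F: "borel_op (\<lambda>t. qsp_F \<theta> (Suc k) (x t)) \<psi>
        = c *\<^sub>C borel_op x (borel_op (\<lambda>t. qsp_F \<theta> k (x t)) \<psi>)
        + (- s) *\<^sub>C borel_op y (borel_op (\<lambda>t. qsp_G \<theta> k (y t)) \<psi>)"
    and G: "borel_op (\<lambda>t. qsp_G \<theta> (Suc k) (x t)) \<psi>
        = c *\<^sub>C borel_op x (borel_op (\<lambda>t. qsp_G \<theta> k (x t)) \<psi>)
        + s *\<^sub>C borel_op y (borel_op (\<lambda>t. qsp_F \<theta> k (y t)) \<psi>)"
    if "x = e \<and> y = v \<or> x = v \<and> y = e" for x y \<psi>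
  proof -
    have xy: "1 / x t = y t" for t
      using that ev by auto
    have b: "bounded_borel x" "bounded_borel y"
      "bounded_borel (\<lambda>t. qsp_F \<theta> k (x t))" "bounded_borel (\<lambda>t. qsp_G \<theta> k (x t))"
      "bounded_borel (\<lambda>t. qsp_F \<theta> k (y t))" "bounded_borel (\<lambda>t. qsp_G \<theta> k (y t))"
      using that bounded by auto
    show "borel_op (\<lambda>t. qsp_F \<theta> (Suc k) (x t)) \<psi>
        = c *\<^sub>C borel_op x (borel_op (\<lambda>t. qsp_F \<theta> k (x t)) \<psi>)
        + (- s) *\<^sub>C borel_op y (borel_op (\<lambda>t. qsp_G \<theta> k (y t)) \<psi>)"
      using borel_op_lincomb[OF b(1,3,2,6), of c "- s" \<psi>] by (simp add: qsp_F_Suc xy c_def s_def)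
    show "borel_op (\<lambda>t. qsp_G \<theta> (Suc k) (x t)) \<psi>
        = c *\<^sub>C borel_op x (borel_op (\<lambda>t. qsp_G \<theta> k (x t)) \<psi>)
        + s *\<^sub>C borel_op y (borel_op (\<lambda>t. qsp_F \<theta> k (y t)) \<psi>)"
      using borel_op_lincomb[OF b(1,4,2,5), of c s \<psi>] by (simp add: qsp_G_Suc xy c_def s_def)
  qed
  note FG = F[OF disjI1, OF conjI, OF refl refl] F[OF disjI2, OF conjI, OF refl refl]
    G[OF disjI1, OF conjI, OF refl refl] G[OF disjI2, OF conjI, OF refl refl]
  have ii: "\<i> * (\<i> * a) = - a" for a
    by (simp flip: mult.assoc)
  show ?case
  proof (rule ext)
    fix x :: "'a \<times> 'a"
    obtain u w where x: "x = (u, w)"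
      by fastforce
    show "qsp (block (borel_op e) (\<lambda>\<psi>. 0) (\<lambda>\<psi>. 0) (borel_op (\<lambda>t. 1 / e t))) \<theta> (Suc k) x
      = block (borel_op (\<lambda>t. qsp_F \<theta> (Suc k) (e t))) (\<lambda>\<psi>. \<i> *\<^sub>C borel_op (\<lambda>t. qsp_G \<theta> (Suc k) (e t)) \<psi>)
        (\<lambda>\<psi>. \<i> *\<^sub>C borel_op (\<lambda>t. qsp_G \<theta> (Suc k) (1 / e t)) \<psi>)
        (borel_op (\<lambda>t. qsp_F \<theta> (Suc k) (1 / e t))) x"
      unfolding qsp.simps Suc.IH x_rotation_eq
      by (simp add: x block_def ev FG clinear_map_add[OF linear(1)] clinear_map_add[OF linear(2)]
          clinear_map_scaleC[OF linear(1)] clinear_map_scaleC[OF linear(2)] scaleC_add_right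
          scaleC_scaleC ii mult_ac add_ac flip: c_def s_def)
  qed
qed

end

theorem theorem2:
  fixes h :: "l2 operator" and \<omega> :: "l2 \<Rightarrow> l2" and Wz :: "l2 \<times> l2 \<Rightarrow> l2 \<times> l2" and d :: nat
  assumes "self_adjoint h"
    and "analytic_in_quadratures h"
    and "op_graph \<omega> = fun_calc h (\<lambda>t. exp (- (\<i> * of_real t)))"
    and "op_graph Wz = fun_calc (qubit_tensor h pauli_z) (\<lambda>t. exp (- (\<i> * of_real t)))"
    and "d \<ge> 1"
  shows "unitary \<omega> \<and>
    Wz = block \<omega> (\<lambda>\<psi>. 0) (\<lambda>\<psi>. 0) (inv \<omega>) \<and>
    (\<forall>n::int. op_graph (op_powi \<omega> n) = fun_calc h (\<lambda>t. exp (- (\<i> * of_real t * of_int n)))) \<and>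
    (\<forall>\<theta>. \<exists>f g :: int \<Rightarrow> real.
       qsp Wz \<theta> d =
         block (laurent_op d f \<omega>) (\<lambda>\<psi>. \<i> *\<^sub>C laurent_op d g \<omega> \<psi>)
               (\<lambda>\<psi>. \<i> *\<^sub>C laurent_op d g (inv \<omega>) \<psi>) (laurent_op d f (inv \<omega>)) \<and>
       (\<forall>\<psi>. laurent_op d f \<omega> (laurent_op d f (inv \<omega>) \<psi>) +
            laurent_op d g \<omega> (laurent_op d g (inv \<omega>) \<psi>) = \<psi>) \<and>
       (\<forall>z. z \<noteq> 0 \<longrightarrow> laurent_eval d f z * laurent_eval d f (1 / z) +
            laurent_eval d g z * laurent_eval d g (1 / z) = 1)) \<and>
    (\<forall>f :: int \<Rightarrow> real.
       (\<forall>z. cmod z = 1 \<longrightarrow> laurent_eval d f z * laurent_eval d f (1 / z) < 1) \<longrightarrow>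
       (\<exists>\<theta>. upper_left (qsp Wz \<theta> d) = laurent_op d f \<omega>))"
proof -
  have phase: "phase = (\<lambda>t. exp (- (\<i> * of_real t)))"
    by (simp add: phase_def fun_eq_iff)
  obtain E where "complete_pvm E" and \<omega>: "\<omega> = complete_pvm.borel_op E phase"
    and Wz: "Wz = block \<omega> (\<lambda>\<psi>. 0) (\<lambda>\<psi>. 0) (inv \<omega>)"
    and powers: "\<And>n. op_graph (op_powi \<omega> n) = fun_calc h (\<lambda>t. phase t powi n)"
    using generated_operators[of \<omega> h Wz] assms(3,4) unfolding phase by blast
  interpret complete_pvm E
    by fact
  note e = bounded_borel_phase cmod_phase
  have e': "bounded_borel (\<lambda>t. 1 / phase t)" "cmod (1 / phase t) = 1" for t
    using bounded_borel_cnj[OF e(1)] by (simp_all add: phase_minus)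
  have nz: "phase t \<noteq> 0" for t
    using cmod_phase[of t] by (metis norm_zero zero_neq_one)
  have inv_\<omega>: "inv \<omega> = borel_op (\<lambda>t. 1 / phase t)"
    using inv_borel_op_unit[OF e] by (simp add: \<omega> phase_minus)
  have lop: "laurent_op d f \<omega> = borel_op (\<lambda>t. laurent_eval d f (phase t))"
    "laurent_op d f (inv \<omega>) = borel_op (\<lambda>t. laurent_eval d f (1 / phase t))" for f
    unfolding inv_\<omega> unfolding \<omega> by (rule laurent_op_borel_op[OF e] laurent_op_borel_op[OF e'])+
  note bounded = bounded_borel_laurent_eval[OF e] bounded_borel_laurent_eval[OF e']
  \<comment> \<open>Shared by both directions: agreement with the scalar sequence away from 0 is
    enough, since \<open>phase\<close> never vanishes.\<close>
  have block_form: "qsp Wz \<theta> d =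
         block (laurent_op d f \<omega>) (\<lambda>\<psi>. \<i> *\<^sub>C laurent_op d g \<omega> \<psi>)
               (\<lambda>\<psi>. \<i> *\<^sub>C laurent_op d g (inv \<omega>) \<psi>) (laurent_op d f (inv \<omega>))"
    if "\<And>z. z \<noteq> 0 \<Longrightarrow> qsp_F \<theta> d z = laurent_eval d f z" "\<And>z. z \<noteq> 0 \<Longrightarrow> qsp_G \<theta> d z = laurent_eval d g z"
    for \<theta> f g
    unfolding Wz lop unfolding inv_\<omega> unfolding \<omega>
    using qsp_borel_op[OF e, of \<theta> d] that nz by simp
  show ?thesis
  proof (intro conjI allI impI)
    show "unitary \<omega>"
      unfolding \<omega> by (rule unitary_borel_op[OF e])
    show "op_graph (op_powi \<omega> n) = fun_calc h (\<lambda>t. exp (- (\<i> * of_real t * of_int n)))" for n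
      using powers by (simp add: phase_power_int)
  next
    fix \<theta>
    obtain f g where fg: "qsp_F \<theta> d z = laurent_eval d f z" "qsp_G \<theta> d z = laurent_eval d g z"
      if "z \<noteq> 0" for z
      using qsp_laurent[of \<theta> d] by blast
    have norm: "laurent_eval d f z * laurent_eval d f (1 / z)
        + laurent_eval d g z * laurent_eval d g (1 / z) = 1" if "z \<noteq> 0" for z
      using qsp_unit_norm[OF that, of \<theta> d] that by (simp add: fg)
    \<comment> \<open>Multiplicativity turns the operator identity into the scalar one at
      \<open>phase t\<close>.\<close>
    have "laurent_op d f \<omega> (laurent_op d f (inv \<omega>) \<psi>) + laurent_op d g \<omega> (laurent_op d g (inv \<omega>) \<psi>)
        = borel_op (\<lambda>t. laurent_eval d f (phase t) * laurent_eval d f (1 / phase t)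
            + laurent_eval d g (phase t) * laurent_eval d g (1 / phase t)) \<psi>" for \<psi>
      by (simp only: lop borel_op_add borel_op_mult bounded_borel_mult bounded)
    then have "laurent_op d f \<omega> (laurent_op d f (inv \<omega>) \<psi>) + laurent_op d g \<omega> (laurent_op d g (inv \<omega>) \<psi>) = \<psi>" for \<psi>
      by (simp only: norm[OF nz] borel_op_one)
    then show "\<exists>f g :: int \<Rightarrow> real.
       qsp Wz \<theta> d =
         block (laurent_op d f \<omega>) (\<lambda>\<psi>. \<i> *\<^sub>C laurent_op d g \<omega> \<psi>)
               (\<lambda>\<psi>. \<i> *\<^sub>C laurent_op d g (inv \<omega>) \<psi>) (laurent_op d f (inv \<omega>)) \<and>
       (\<forall>\<psi>. laurent_op d f \<omega> (laurent_op d f (inv \<omega>) \<psi>) +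
            laurent_op d g \<omega> (laurent_op d g (inv \<omega>) \<psi>) = \<psi>) \<and>
       (\<forall>z. z \<noteq> 0 \<longrightarrow> laurent_eval d f z * laurent_eval d f (1 / z) +
            laurent_eval d g z * laurent_eval d g (1 / z) = 1)"
      using block_form[of \<theta> f g] fg norm by blast
  next
    fix f :: "int \<Rightarrow> real"
    assume "\<forall>z. cmod z = 1 \<longrightarrow> laurent_eval d f z * laurent_eval d f (1 / z) < 1"
    then obtain g where "\<And>z. z \<noteq> 0 \<Longrightarrow> laurent_eval d f z * laurent_eval d f (1 / z)
        + laurent_eval d g z * laurent_eval d g (1 / z) = 1"
      using ex_complementary_laurent[of d f] by blast
    then obtain \<theta> where "\<forall>z. z \<noteq> 0 \<longrightarrow> qsp_F \<theta> d z = laurent_eval d f z \<and> qsp_G \<theta> d z = laurent_eval d g z"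
      using ex_qsp_angles by blast
    then have Q: "qsp Wz \<theta> d =
         block (laurent_op d f \<omega>) (\<lambda>\<psi>. \<i> *\<^sub>C laurent_op d g \<omega> \<psi>)
               (\<lambda>\<psi>. \<i> *\<^sub>C laurent_op d g (inv \<omega>) \<psi>) (laurent_op d f (inv \<omega>))"
      by (intro block_form) auto
    \<comment> \<open>\<open>upper_left\<close> applies the operator to \<open>(u, 0)\<close>, so
      the upper right block is evaluated at 0.\<close>
    have "laurent_op d g \<omega> 0 = 0"
      using clinear_map_scaleC[OF clinear_borel_op[OF bounded(1)], of _ _ 0 0] by (simp add: lop)
    then show "\<exists>\<theta>. upper_left (qsp Wz \<theta> d) = laurent_op d f \<omega>"
      by (intro exI[of _ \<theta>]) (simp add: Q upper_left_def block_def fun_eq_iff)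
  qed (fact Wz)
qed

end
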